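(* Let $a_1,\dots,a_n$ be positive integers with $\gcd(a_1,\dots,a_n)=1$ whose sum $m$ is not a power of two, and let $P=(p_1,\dots,p_n)$ with $p_i=a_i/m$. Write $m=2^u x$ with $x>1$ odd and $u\ge0$, and let $\ell$ be the multiplicative order of $2$ modulo $x$. Let $q_i=c\,a_i/2^{u+\ell}$ where $c=\lfloor 2^{u+\ell}/m\rfloor$. The following are equivalent: (1) for some integer $K$ with $\lceil\log m\rceil\le K\le u+\ell$, the tree $\mathrm{ALDR}[P,K]$ is entropy optimal; (2) $\mathrm{ALDR}[P,u+\ell]$ is entropy optimal; (3) for all $1\le i\le n$, $(1-z^\ell)\sum_d \epsilon_d(p_i)z^d=\sum_d\epsilon_d(q_i)z^d$ as formal power series; (4) for all $1\le i\le n$, the formal power series $(1-z^\ell)\sum_d\epsilon_d(p_i)z^d$ has only nonnegative coefficients; (5) for all $d\ge1$ and $1\le i\le n$, $\epsilon_d(p_i)\le\epsilon_{d+\ell}(p_i)$.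
   Context: All logarithms are base 2. For real $x\ge0$ and integer $d$, $\epsilon_d(x)=\lfloor2^dx\rfloor\bmod2$ (the $d$th binary digit after the point for $x\in[0,1)$), and $\nu(x)=\sum_d d\,\epsilon_d(x)2^{-d}$. A DDG tree is a sampler driven by i.i.d. fair bits: a binary tree (possibly with back edges to the root) with labeled leaves traversed from the root one fair bit per step until a leaf is reached, whose label is output. A DDG tree with output distribution $P$ is entropy optimal if its expected number of consumed bits is minimal among all DDG trees with output distribution $P$; equivalently, after unrolling all back edges, it has exactly $\epsilon_d(p_i)$ leaves labeled $i$ at depth $d$ for every $i$ and $d$. FLDR: for positive integers $A_1,\dots,A_n$ with sum $M$, $K'=\lceil\log M\rceil$, $A_0=2^{K'}-M$, $Q=(A_0/2^{K'},\dots,A_n/2^{K'})$; $\mathrm{FLDR}[A_1,\dots,A_n]$ is an entropy-optimal DDG tree for $Q$ (exactly $\epsilon_d(A_i/2^{K'})$ leaves labeled $i$ at depth $d$) with every leaf labeled $0$ replaced by a back edge to the root; its output distribution is $(A_i/M)$. For integer $K\ge\lceil\log m\rceil$, $c_K=\lfloor2^K/m\rfloor$ and $\mathrm{ALDR}[P,K]=\mathrm{FLDR}[c_Ka_1,\dots,c_Ka_n]$. *)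

theory Defs
  imports "HOL-Probability.Probability" "HOL-Number_Theory.Number_Theory"
    "HOL-Computational_Algebra.Formal_Power_Series"
begin

subsection \<open>Binary digits\<close>

definition eps :: "int \<Rightarrow> real \<Rightarrow> int" where
  "eps d x = \<lfloor>2 powi d * x\<rfloor> mod 2"

text \<open>For \<open>x \<in> [0,1)\<close> all digits with index \<open>d \<le> 0\<close> vanish, so nothing is lost by summing over
  \<open>d \<ge> 0\<close> only.\<close>

definition digit_fps :: "real \<Rightarrow> int fps" where
  "digit_fps x = Abs_fps (\<lambda>d. eps (int d) x)"

subsection \<open>DDG trees\<close>

text \<open>Trees may be infinite. An occurrence of \<open>Back\<close> is not a node of its own: an edge leading to it
  is an edge leading back to the root.\<close>

codatatype 'a ddg = Leaf 'a | Node "'a ddg" "'a ddg" | Back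

primrec node_at :: "'a ddg \<Rightarrow> bool list \<Rightarrow> 'a ddg option" where
  "node_at t [] = Some t"
| "node_at t (b # bs) = (case t of Node l r \<Rightarrow> node_at (if b then r else l) bs | _ \<Rightarrow> None)"

definition leaf_count :: "'a ddg \<Rightarrow> nat \<Rightarrow> 'a \<Rightarrow> nat" where
  "leaf_count t d i = card {w. length w = d \<and> node_at t w = Some (Leaf i)}"

text \<open>\<open>unroll_from r t\<close> replaces every back edge in \<open>t\<close> by a fresh unrolled copy of \<open>r\<close>.
  Following a back edge consumes no bit.\<close>

primcorec unroll_from :: "'a ddg \<Rightarrow> 'a ddg \<Rightarrow> 'a ddg" where
  "unroll_from r t =
    (case (if t = Back then r else t) of
       Leaf a \<Rightarrow> Leaf a
     | Node t1 t2 \<Rightarrow> Node (unroll_from r t1) (unroll_from r t2)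
     | Back \<Rightarrow> Back)"

definition unroll :: "'a ddg \<Rightarrow> 'a ddg" where
  "unroll t = unroll_from t t"

definition fair_bits :: "bool stream measure" where
  "fair_bits = stream_space (measure_pmf (bernoulli_pmf (1/2)))"

definition outputs :: "'a ddg \<Rightarrow> bool stream \<Rightarrow> 'a \<Rightarrow> bool" where
  "outputs t \<omega> i \<longleftrightarrow> (\<exists>k. node_at (unroll t) (stake k \<omega>) = Some (Leaf i))"

text \<open>The infimum of the empty set is \<open>\<infinity>\<close>, the value for a run that never reaches a leaf.\<close>

definition bits_consumed :: "'a ddg \<Rightarrow> bool stream \<Rightarrow> enat" where
  "bits_consumed t \<omega> = Inf {enat k | k. \<exists>i. node_at (unroll t) (stake k \<omega>) = Some (Leaf i)}"

definition expected_bits :: "'a ddg \<Rightarrow> ennreal" where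
  "expected_bits t = (\<integral>\<^sup>+ \<omega>. ennreal_of_enat (bits_consumed t \<omega>) \<partial>fair_bits)"

definition has_output_distribution :: "'a ddg \<Rightarrow> ('a \<Rightarrow> real) \<Rightarrow> bool" where
  "has_output_distribution t P \<longleftrightarrow> (\<forall>i. measure fair_bits {\<omega>. outputs t \<omega> i} = P i)"

definition entropy_optimal :: "('a \<Rightarrow> real) \<Rightarrow> 'a ddg \<Rightarrow> bool" where
  "entropy_optimal P t \<longleftrightarrow> has_output_distribution t P \<and>
     (\<forall>t'. has_output_distribution t' P \<longrightarrow> expected_bits t \<le> expected_bits t')"

subsection \<open>FLDR and ALDR\<close>

primcorec reject :: "'a \<Rightarrow> 'a ddg \<Rightarrow> 'a ddg" where
  "reject z t =
    (case t of
       Leaf a \<Rightarrow> if a = z then Back else Leaf a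
     | Node t1 t2 \<Rightarrow> Node (reject z t1) (reject z t2)
     | Back \<Rightarrow> Back)"

text \<open>Weights \<open>A 1, \<dots>, A n\<close> are given by a function on \<open>{1..n}\<close>; its other values, in particular
  \<open>A 0\<close>, are ignored.\<close>

definition fldr_depth :: "nat \<Rightarrow> (nat \<Rightarrow> nat) \<Rightarrow> nat" where
  "fldr_depth n A = nat \<lceil>log 2 (real (\<Sum>i=1..n. A i))\<rceil>"

definition fldr_proposal :: "nat \<Rightarrow> (nat \<Rightarrow> nat) \<Rightarrow> nat \<Rightarrow> real" where
  "fldr_proposal n A i =
    (if i = 0 then real (2 ^ fldr_depth n A - (\<Sum>j=1..n. A j)) / 2 ^ fldr_depth n A
     else if i \<le> n then real (A i) / 2 ^ fldr_depth n A
     else 0)"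

text \<open>The tree is only determined up to the arrangement of the leaves within each level, so FLDR is a
  predicate on trees. The proposal probabilities sum to 1, hence the leaf counts force \<open>t0\<close> to be
  free of back edges.\<close>

definition is_FLDR :: "nat \<Rightarrow> (nat \<Rightarrow> nat) \<Rightarrow> nat ddg \<Rightarrow> bool" where
  "is_FLDR n A t \<longleftrightarrow>
    (\<exists>t0. (\<forall>d i. int (leaf_count t0 d i) = eps (int d) (fldr_proposal n A i)) \<and> t = reject 0 t0)"

definition is_ALDR :: "nat \<Rightarrow> (nat \<Rightarrow> nat) \<Rightarrow> nat \<Rightarrow> nat ddg \<Rightarrow> bool" where
  "is_ALDR n a K t \<longleftrightarrow> is_FLDR n (\<lambda>i. (2 ^ K div (\<Sum>j=1..n. a j)) * a i) t"

subsection \<open>Equivalence of several statements\<close>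

definition all_equivalent :: "bool list \<Rightarrow> bool" where
  "all_equivalent Ps \<longleftrightarrow> (\<forall>P\<in>set Ps. \<forall>Q\<in>set Ps. P \<longleftrightarrow> Q)"

subsection \<open>FLDR and ALDR trees exist\<close>

lemma leaf_count_0:
  "leaf_count t 0 i = (if t = Leaf i then 1 else 0)"
proof -
  have "{w. length w = 0 \<and> node_at t w = Some (Leaf i)} = (if t = Leaf i then {[]} else {})"
    by auto
  then show ?thesis by (simp add: leaf_count_def)
qed

lemma leaf_count_Leaf_Suc: "leaf_count (Leaf j) (Suc d) i = 0"
proof -
  have "{w. length w = Suc d \<and> node_at (Leaf j) w = Some (Leaf i)} = {}"
    by (auto simp: length_Suc_conv)
  then show ?thesis unfolding leaf_count_def by (simp only: card.empty)
qed

lemma leaf_count_Node_Suc: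
  "leaf_count (Node l r) (Suc d) i = leaf_count l d i + leaf_count r d i"
proof -
  let ?S = "\<lambda>t. {w. length w = d \<and> node_at t w = Some (Leaf i)}"
  have fin: "finite (?S t)" for t :: "'a ddg"
    by (rule finite_subset[OF _ finite_lists_length_eq[OF finite, of UNIV d]]) auto
  have "{w. length w = Suc d \<and> node_at (Node l r) w = Some (Leaf i)}
      = (#) False ` ?S l \<union> (#) True ` ?S r"
    by (auto simp: length_Suc_conv split: if_splits)
  moreover have "card ((#) False ` ?S l \<union> (#) True ` ?S r) = card (?S l) + card (?S r)"
    by (subst card_Un_disjoint) (auto simp: fin card_image)
  ultimately show ?thesis by (simp add: leaf_count_def)
qed

lemma ex_paired_forest:
  "length ts = 2 * k \<Longrightarrow> \<exists>us. length us = k \<and> (\<forall>u\<in>set us. \<exists>l r. u = Node l r) \<and>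
     (\<forall>d i. (\<Sum>u\<leftarrow>us. leaf_count u (Suc d) i) = (\<Sum>t\<leftarrow>ts. leaf_count t d i))"
proof (induction k arbitrary: ts)
  case 0
  then show ?case by simp
next
  case (Suc k)
  then obtain l r ts' where ts: "ts = l # r # ts'" "length ts' = 2 * k"
    by (metis (no_types, lifting) add_2_eq_Suc length_Suc_conv mult_Suc_right)
  from Suc.IH[OF ts(2)] obtain us where
    us: "length us = k" "\<forall>u\<in>set us. \<exists>l r. u = Node l r"
      "\<forall>d i. (\<Sum>u\<leftarrow>us. leaf_count u (Suc d) i) = (\<Sum>t\<leftarrow>ts'. leaf_count t d i)"
    by blast
  show ?case
    by (rule exI[of _ "Node l r # us"]) (use us in \<open>auto simp: ts leaf_count_Node_Suc\<close>)
qed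

lemma ex_tree_with_leaves:
  fixes L :: "nat \<Rightarrow> 'a list"
  assumes "length ts + (\<Sum>d<K. length (L d) * 2 ^ (K - d)) = 2 ^ K"
  shows "\<exists>t. \<forall>d i. leaf_count t d i =
    (if d < K then count_list (L d) i else (\<Sum>u\<leftarrow>ts. leaf_count u (d - K) i))"
  using assms
proof (induction K arbitrary: ts)
  case 0
  then obtain t where "ts = [t]" by (auto simp: length_Suc_conv)
  then show ?case by auto
next
  case (Suc K)
  have *: "(\<Sum>d<K. length (L d) * 2 ^ (Suc K - d)) = 2 * (\<Sum>d<K. length (L d) * 2 ^ (K - d))"
    unfolding sum_distrib_left by (rule sum.cong) (auto simp: Suc_diff_le)
  have eq: "length ts + 2 * (\<Sum>d<K. length (L d) * 2 ^ (K - d)) + 2 * length (L K) = 2 * 2 ^ K"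
    using Suc.prems * by simp
  then have "even (length ts)" by presburger
  then obtain k where k: "length ts = 2 * k" by (elim evenE)
  from ex_paired_forest[OF k] obtain us where
    us: "length us = k" "\<forall>u\<in>set us. \<exists>l r. u = Node l r"
      "\<forall>d i. (\<Sum>u\<leftarrow>us. leaf_count u (Suc d) i) = (\<Sum>t\<leftarrow>ts. leaf_count t d i)"
    by blast
  have "length (map Leaf (L K) @ us) + (\<Sum>d<K. length (L d) * 2 ^ (K - d)) = 2 ^ K"
    using eq k us(1) by simp
  from Suc.IH[OF this] obtain t where t: "\<And>d i. leaf_count t d i =
    (if d < K then count_list (L d) i
     else (\<Sum>u\<leftarrow>map Leaf (L K) @ us. leaf_count u (d - K) i))" by blast
  have us0: "(\<Sum>u\<leftarrow>us. leaf_count u 0 i) = 0" for i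
    using us(2) by (auto simp: leaf_count_0 intro!: sum_list_0)
  have L0: "(\<Sum>j\<leftarrow>xs. leaf_count (Leaf j) 0 i) = count_list xs i" for xs and i :: 'a
    by (induction xs) (auto simp: leaf_count_0)
  have LS: "(\<Sum>j\<leftarrow>xs. leaf_count (Leaf j) (Suc d) i) = 0" for xs d and i :: 'a
    by (induction xs) (auto simp: leaf_count_Leaf_Suc)
  show ?case
  proof (intro exI[of _ t] allI)
    fix d i
    consider "d < K" | "d = K" | e where "d = Suc K + e"
      by (metis Suc_leI le_Suc_ex linorder_neqE_nat)
    then show "leaf_count t d i =
      (if d < Suc K then count_list (L d) i else (\<Sum>u\<leftarrow>ts. leaf_count u (d - Suc K) i))"
    proof cases
      case 3
      then have "d - K = Suc e" by simp
      with 3 show ?thesis using us(3) by (simp add: t LS comp_def)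
    qed (simp_all add: t us0 L0 comp_def)
  qed
qed

lemma eps_dyadic:
  "eps (int d) (real N / 2 ^ K) = (if d \<le> K then int (N div 2 ^ (K - d) mod 2) else 0)"
proof (cases "d \<le> K")
  case True
  then have "2 ^ d * (real N / 2 ^ K) = real N / real (2 ^ (K - d))"
    by (auto simp: le_iff_add power_add)
  moreover have "\<lfloor>real N / real (2 ^ (K - d))\<rfloor> = int (N div 2 ^ (K - d))"
    by (rule floor_divide_of_nat_eq)
  ultimately show ?thesis
    using True by (simp add: eps_def power_int_def zmod_int)
next
  case False
  then obtain e where e: "d = Suc (K + e)"
    by (metis less_iff_Suc_add not_le)
  have "2 ^ d * (real N / 2 ^ K) = of_int (2 * (2 ^ e * int N))"
    by (simp add: e power_add)
  then have "\<lfloor>2 ^ d * (real N / 2 ^ K)\<rfloor> = 2 * (2 ^ e * int N)"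
    by (simp only: floor_of_int)
  then show ?thesis using False by (simp add: eps_def power_int_def)
qed

lemma sum_bits:
  fixes N :: nat
  shows "(\<Sum>d<Suc K. (N div 2 ^ (K - d) mod 2) * 2 ^ (Suc K - d)) = 2 * (N mod 2 ^ Suc K)"
proof -
  have "(\<Sum>d<k. (N div 2 ^ d mod 2) * 2 ^ Suc d) = 2 * (N mod 2 ^ k)" for k
  proof (induction k)
    case (Suc k)
    have "N mod 2 ^ Suc k = 2 ^ k * (N div 2 ^ k mod 2) + N mod 2 ^ k"
      by (metis mod_mult2_eq power_Suc2)
    with Suc show ?case by simp
  qed simp
  from this[of "Suc K"] show ?thesis
    by (subst (asm) sum.nat_diff_reindex[symmetric])
      (simp add: Suc_diff_le cong: sum.cong_simp)
qed

lemma le_power2_of_log_le: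
  assumes "0 < (m :: nat)" and "log 2 (real m) \<le> real K"
  shows "m \<le> 2 ^ K"
proof -
  have "real m \<le> 2 powr real K"
    using assms by (simp add: log_le_iff)
  then have "real m \<le> real (2 ^ K)"
    by (simp add: powr_realpow)
  then show ?thesis by (simp only: of_nat_le_iff)
qed

lemma ex_is_FLDR:
  assumes "0 < (\<Sum>i=1..n. A i)"
  shows "\<exists>t. is_FLDR n A t"
proof -
  define M where "M = (\<Sum>i=1..n. A i)"
  define K where "K = fldr_depth n A"
  define B where "B i = (if i = 0 then 2 ^ K - M else if i \<le> n then A i else 0)" for i
  define L where "L d = filter (\<lambda>i. odd (B i div 2 ^ (K - d))) [0..<Suc n]" for d
  have "log 2 (real M) \<le> real K"
    by (simp add: K_def M_def fldr_depth_def) linarith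
  then have MK: "M \<le> 2 ^ K"
    using assms by (intro le_power2_of_log_le) (simp_all only: M_def)
  have sumB: "(\<Sum>i<Suc n. B i) = 2 ^ K"
  proof -
    have "(\<Sum>i<Suc n. B i) = B 0 + (\<Sum>i=1..n. B i)"
      unfolding lessThan_Suc_atMost atMost_atLeast0
      by (subst sum.atLeast_Suc_atMost) auto
    also have "(\<Sum>i=1..n. B i) = M"
      unfolding M_def by (rule sum.cong) (auto simp: B_def)
    finally show ?thesis using MK by (simp add: B_def)
  qed
  have Ble: "B i \<le> 2 ^ K" if "i < Suc n" for i
    using member_le_sum[of i "{..<Suc n}" B] that sumB by simp
  have len: "length (L d) = (\<Sum>i<Suc n. B i div 2 ^ (K - d) mod 2)" for d
  proof -
    have length_filter: "length (filter (\<lambda>i. odd (B i div 2 ^ (K - d))) xs)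
        = (\<Sum>i\<leftarrow>xs. B i div 2 ^ (K - d) mod 2)" for xs
      by (induction xs) (auto simp: odd_iff_mod_2_eq_one)
    have "length (L d) = (\<Sum>i\<leftarrow>[0..<Suc n]. B i div 2 ^ (K - d) mod 2)"
      unfolding L_def by (rule length_filter)
    then show ?thesis
      by (simp add: interv_sum_list_conv_sum_set_nat atLeast0LessThan)
  qed
  have "(\<Sum>d<Suc K. length (L d) * 2 ^ (Suc K - d))
      = (\<Sum>i<Suc n. \<Sum>d<Suc K. (B i div 2 ^ (K - d) mod 2) * 2 ^ (Suc K - d))"
    unfolding len sum_distrib_right by (rule sum.swap)
  also have "\<dots> = (\<Sum>i<Suc n. 2 * B i)"
  proof (rule sum.cong[OF refl])
    fix i assume "i \<in> {..<Suc n}"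
    then have "B i < 2 ^ Suc K" using Ble[of i] by (simp add: le_less_trans)
    then show "(\<Sum>d<Suc K. (B i div 2 ^ (K - d) mod 2) * 2 ^ (Suc K - d)) = 2 * B i"
      unfolding sum_bits by simp
  qed
  also have "\<dots> = 2 ^ Suc K" using sumB by (simp flip: sum_distrib_left)
  finally have "length ([] :: nat ddg list) + (\<Sum>d<Suc K. length (L d) * 2 ^ (Suc K - d)) = 2 ^ Suc K"
    by simp
  from ex_tree_with_leaves[OF this]
  have "\<exists>t0. \<forall>d i. leaf_count t0 d i = (if d < Suc K then count_list (L d) i else 0)"
    by (simp only: list.map sum_list.Nil)
  then obtain t0 where
    t0: "\<And>d i. leaf_count t0 d i = (if d < Suc K then count_list (L d) i else 0)"
    by blast
  have cnt: "count_list (L d) i = B i div 2 ^ (K - d) mod 2" for d i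
  proof -
    have "distinct xs \<Longrightarrow> count_list xs i = (if i \<in> set xs then 1 else 0)" for xs
      by (induction xs) auto
    then have "count_list (L d) i = (if i \<in> set (L d) then 1 else 0)"
      by (simp add: L_def)
    also have "\<dots> = B i div 2 ^ (K - d) mod 2"
      by (auto simp: L_def B_def odd_iff_mod_2_eq_one)
    finally show ?thesis .
  qed
  have proposal: "fldr_proposal n A i = real (B i) / 2 ^ K" for i
    by (simp add: fldr_proposal_def B_def M_def K_def)
  have "int (leaf_count t0 d i) = eps (int d) (fldr_proposal n A i)" for d i
    unfolding proposal eps_dyadic t0 cnt by simp
  then show ?thesis unfolding is_FLDR_def by blast
qed

lemma ex_is_ALDR:
  assumes "0 < (\<Sum>i=1..n. a i)" and "\<lceil>log 2 (real (\<Sum>i=1..n. a i))\<rceil> \<le> int K"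
  shows "\<exists>t. is_ALDR n a K t"
proof -
  let ?m = "\<Sum>i=1..n. a i"
  have "log 2 (real ?m) \<le> real K" using assms(2) by linarith
  then have "?m \<le> 2 ^ K"
    using assms(1) by (intro le_power2_of_log_le)
  then have "0 < (2 ^ K div ?m) * ?m"
    using assms(1) by (simp add: div_greater_zero_iff)
  then have "0 < (\<Sum>i=1..n. (2 ^ K div ?m) * a i)"
    by (simp only: sum_distrib_left)
  then show ?thesis unfolding is_ALDR_def by (rule ex_is_FLDR)
qed

end

theory Submission
  imports Defs
begin

text \<open>
  If \<open>c\<^sub>i(d)\<close> counts the leaves labelled \<open>i\<close> at depth \<open>d\<close> of an unrolled tree, the expected number of
  bits is \<open>\<Sum>k. (1 - \<Sum>i. \<Sum>d\<le>k. c\<^sub>i(d) / 2^d)\<close>. The inner sum over \<open>d\<close> is a multiple of \<open>1 / 2^k\<close> and at most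
  \<open>p\<^sub>i\<close>, hence at most the truncation of \<open>p\<^sub>i\<close> to \<open>k\<close> binary digits. So a tree is optimal iff its leaf
  counts are the binary digits of the \<open>p\<^sub>i\<close> (Knuth and Yao), because a tree with these counts exists.

  Unrolling the back edges of ALDR divides the generating function of the leaves by \<open>1 - G\<close>, where \<open>G\<close>
  is the generating function of the digits of \<open>(2^K mod m) / 2^K\<close>; for \<open>K = u + l\<close> this is \<open>z^l\<close>. If the
  unrolled counts are digits, then \<open>G\<close> has a single term: two terms would create a coefficient 2.
  Then \<open>2^K mod m\<close> is a power of two, and divisibility by \<open>m\<close> forces \<open>K \<ge> u + l\<close>. Finally,
  \<open>q\<^sub>i = p\<^sub>i - p\<^sub>i / 2^l\<close>, and the last condition says that this subtraction needs no borrow, so it acts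
  digit by digit.
\<close>

section \<open>Leaf counts and back edges\<close>

definition back_count :: "'a ddg \<Rightarrow> nat \<Rightarrow> nat" where
  "back_count t d = card {w. length w = d \<and> node_at t w = Some Back}"

lemma back_count_0: "back_count t 0 = (if t = Back then 1 else 0)"
proof -
  have "{w. length w = 0 \<and> node_at t w = Some Back} = (if t = Back then {[]} else {})"
    by auto
  then show ?thesis by (simp add: back_count_def)
qed

lemma back_count_Suc:
  fixes l r :: "'a ddg" and j :: 'a
  shows "back_count (Leaf j) (Suc d) = 0"
  "back_count (Back :: 'a ddg) (Suc d) = 0"
  "back_count (Node l r) (Suc d) = back_count l d + back_count r d"
proof -
  let ?S = "\<lambda>t. {w. length w = d \<and> node_at t w = Some Back}"
  have fin: "finite (?S t)" for t :: "'a ddg"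
    by (rule finite_subset[OF _ finite_lists_length_eq[OF finite, of UNIV d]]) auto
  have "{w. length w = Suc d \<and> node_at (Node l r) w = Some Back}
      = (#) False ` ?S l \<union> (#) True ` ?S r"
    by (auto simp: length_Suc_conv split: if_splits)
  moreover have "card ((#) False ` ?S l \<union> (#) True ` ?S r) = card (?S l) + card (?S r)"
    by (subst card_Un_disjoint) (auto intro!: finite_imageI fin simp: card_image)
  ultimately show "back_count (Node l r) (Suc d) = back_count l d + back_count r d"
    by (simp add: back_count_def)
  have "{w. length w = Suc d \<and> node_at (Leaf j) w = Some Back} = {}"
    "{w. length w = Suc d \<and> node_at (Back :: 'a ddg) w = Some Back} = {}"
    by (auto simp: length_Suc_conv)
  then show "back_count (Leaf j) (Suc d) = 0" "back_count (Back :: 'a ddg) (Suc d) = 0"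
    unfolding back_count_def by (simp_all only: card.empty)
qed

lemma leaf_count_Back: "leaf_count Back d i = 0"
proof -
  have "{w. length w = d \<and> node_at Back w = Some (Leaf i)} = {}"
    by (cases d) (auto simp: length_Suc_conv)
  then show ?thesis unfolding leaf_count_def by (simp only: card.empty)
qed

lemma back_count_Leaf: "back_count (Leaf j) d = 0"
  by (cases d) (auto simp: back_count_0 back_count_Suc)

lemma back_count_Back: "back_count Back d = (if d = 0 then 1 else 0)"
  by (cases d) (auto simp: back_count_0 back_count_Suc)

lemma reject_simps [simp]:
  fixes t1 t2 :: "'a ddg"
  shows "reject z (Leaf a) = (if a = z then Back else Leaf a)"
  "reject z (Node t1 t2) = Node (reject z t1) (reject z t2)"
  "reject z (Back :: 'a ddg) = Back"
proof -
  show "reject z (Leaf a) = (if a = z then Back else Leaf a)"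
    by (subst reject.code) simp
  show "reject z (Node t1 t2) = Node (reject z t1) (reject z t2)"
    by (subst reject.code) simp
  show "reject z (Back :: 'a ddg) = Back"
    by (subst reject.code) simp
qed

lemma unroll_from_simps:
  "unroll_from r (Leaf a) = Leaf a"
  "unroll_from r (Node t1 t2) = Node (unroll_from r t1) (unroll_from r t2)"
  "unroll_from r Back = unroll_from r r"
proof -
  show "unroll_from r (Leaf a) = Leaf a"
    by (subst unroll_from.code) simp
  show "unroll_from r (Node t1 t2) = Node (unroll_from r t1) (unroll_from r t2)"
    by (subst unroll_from.code) simp
  show "unroll_from r Back = unroll_from r r"
    \<comment> \<open>\<open>Back\<close> is replaced by \<open>r\<close> before the case
      distinction, so both sides unfold to the same term, even for \<open>r = Back\<close>.\<close>
    by (subst (1 2) unroll_from.code) simp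
qed

lemma leaf_count_reject: "leaf_count (reject z t) d i = (if i = z then 0 else leaf_count t d i)"
proof (induction d arbitrary: t)
  case 0
  show ?case by (cases t) (auto simp: leaf_count_0)
next
  case (Suc d)
  then show ?case
    by (cases t) (auto simp: leaf_count_Leaf_Suc leaf_count_Node_Suc leaf_count_Back)
qed

lemma back_count_reject: "back_count (reject z t) d = leaf_count t d z + back_count t d"
proof (induction d arbitrary: t)
  case 0
  show ?case by (cases t) (auto simp: leaf_count_0 back_count_0)
next
  case (Suc d)
  then show ?case
    by (cases t) (auto simp: leaf_count_Leaf_Suc leaf_count_Node_Suc leaf_count_Back back_count_Suc)
qed

text \<open>Paths are split at their first back edge: if it is taken after \<open>k\<close> bits,
  the remaining \<open>d - k\<close> bits are spent in a fresh unrolled copy of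
  \<open>r\<close>.\<close>

lemma leaf_count_unroll_from:
  "leaf_count (unroll_from r t) d i =
     leaf_count t d i + (\<Sum>k\<le>d. back_count t k * leaf_count (unroll_from r r) (d - k) i)"
proof (induction d arbitrary: t)
  case 0
  show ?case
    by (cases t) (auto simp: leaf_count_0 back_count_0 unroll_from_simps)
next
  case (Suc d)
  show ?case
  proof (cases t)
    case (Leaf a)
    then show ?thesis by (simp add: unroll_from_simps back_count_Leaf)
  next
    case (Node t1 t2)
    have "leaf_count (unroll_from r t) (Suc d) i
        = leaf_count t (Suc d) i
          + (\<Sum>k\<le>d. back_count t (Suc k) * leaf_count (unroll_from r r) (d - k) i)"
      by (simp add: Node unroll_from_simps leaf_count_Node_Suc Suc back_count_Suc
          sum.distrib distrib_right)
    then show ?thesis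
      by (simp add: sum.atMost_Suc_shift Node back_count_0 del: sum.atMost_Suc)
  next
    case Back
    have "(\<Sum>k\<le>Suc d. back_count t k * leaf_count (unroll_from r r) (Suc d - k) i)
        = (\<Sum>k\<le>Suc d. if k = 0 then leaf_count (unroll_from r r) (Suc d) i else 0)"
      by (rule sum.cong) (auto simp: Back back_count_Back)
    then show ?thesis by (simp add: Back unroll_from_simps leaf_count_Back)
  qed
qed

section \<open>Generating functions of leaves and back edges\<close>

definition leaf_fps :: "'a ddg \<Rightarrow> 'a \<Rightarrow> int fps" where
  "leaf_fps t i = Abs_fps (\<lambda>d. int (leaf_count t d i))"

definition back_fps :: "'a ddg \<Rightarrow> int fps" where
  "back_fps t = Abs_fps (\<lambda>d. int (back_count t d))"

lemma leaf_fps_nth [simp]: "fps_nth (leaf_fps t i) d = int (leaf_count t d i)"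
  by (simp add: leaf_fps_def)

lemma back_fps_nth [simp]: "fps_nth (back_fps t) d = int (back_count t d)"
  by (simp add: back_fps_def)

text \<open>This is the renewal equation of the restarting sampler: the convolution over first back
  edges becomes a product of power series.\<close>

lemma leaf_fps_unroll: "leaf_fps (unroll t) i = leaf_fps t i + back_fps t * leaf_fps (unroll t) i"
proof (rule fps_ext)
  fix d
  have "leaf_count (unroll t) d i
      = leaf_count t d i + (\<Sum>k\<le>d. back_count t k * leaf_count (unroll t) (d - k) i)"
    unfolding unroll_def by (rule leaf_count_unroll_from)
  then show "fps_nth (leaf_fps (unroll t) i) d
      = fps_nth (leaf_fps t i + back_fps t * leaf_fps (unroll t) i) d"
    by (simp add: fps_mult_nth atMost_atLeast0)
qed

text \<open>Kraft's inequality, with back edges counted as terminal nodes.\<close>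

lemma kraft_leaves_back:
  assumes "finite I"
  shows "(\<Sum>d\<le>D. (back_count t d + (\<Sum>i\<in>I. leaf_count t d i)) * 2 ^ (D - d)) \<le> 2 ^ D"
proof (induction D arbitrary: t)
  case 0
  have "back_count t 0 + (\<Sum>i\<in>I. leaf_count t 0 i) \<le> 1"
    using assms by (cases t) (auto simp: back_count_0 leaf_count_0 sum.delta')
  then show ?case by simp
next
  case (Suc D)
  let ?f = "\<lambda>t d. back_count t d + (\<Sum>i\<in>I. leaf_count t d i)"
  \<comment> \<open>Depth 0 is split off; for a \<open>Node\<close> the remaining sum is shared
    between the two subtrees, each with budget \<open>2 ^ D\<close>.\<close>
  have shift: "(\<Sum>d\<le>Suc D. ?f t d * 2 ^ (Suc D - d))
      = ?f t 0 * 2 ^ Suc D + (\<Sum>d\<le>D. ?f t (Suc d) * 2 ^ (D - d))"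
    by (simp add: sum.atMost_Suc_shift del: sum.atMost_Suc)
  show ?case
  proof (cases t)
    case (Leaf a)
    then show ?thesis unfolding shift
      using assms by (auto simp: back_count_0 leaf_count_0 back_count_Suc leaf_count_Leaf_Suc sum.delta')
  next
    case (Node t1 t2)
    have "(\<Sum>d\<le>D. ?f t (Suc d) * 2 ^ (D - d))
        = (\<Sum>d\<le>D. ?f t1 d * 2 ^ (D - d)) + (\<Sum>d\<le>D. ?f t2 d * 2 ^ (D - d))"
      by (simp add: Node back_count_Suc leaf_count_Node_Suc sum.distrib algebra_simps)
    then show ?thesis unfolding shift
      using Suc[of t1] Suc[of t2] by (simp add: Node back_count_0 leaf_count_0)
  next
    case Back
    then show ?thesis unfolding shift
      by (auto simp: back_count_0 leaf_count_0 back_count_Suc leaf_count_Back)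
  qed
qed

section \<open>Fair bits\<close>

interpretation fair_bits: prob_space fair_bits
  unfolding fair_bits_def
  by (rule prob_space.prob_space_stream_space) (rule prob_space_measure_pmf)

lemma space_fair_bits [simp]: "space fair_bits = UNIV"
  by (simp add: fair_bits_def space_stream_space)

lemma sets_fair_bits [measurable_cong]:
  "sets fair_bits = sets (stream_space (count_space UNIV))"
  unfolding fair_bits_def by (rule sets_stream_space_cong) simp

lemma measurable_stake_fair_bits [measurable]: "stake k \<in> fair_bits \<rightarrow>\<^sub>M count_space UNIV"
  by measurable

lemma prefix_event_sets [measurable]: "{\<omega>. stake k \<omega> \<in> X} \<in> sets fair_bits"
proof -
  have "{\<omega> \<in> space fair_bits. stake k \<omega> \<in> X} \<in> sets fair_bits"
    by measurable
  then show ?thesis by simp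
qed

text \<open>The stream space is split into its first bit and an independent tail; a matching first
  bit contributes the factor 1/2.\<close>

lemma emeasure_stake_eq: "emeasure fair_bits {\<omega>. stake (length w) \<omega> = w} = ennreal ((1/2) ^ length w)"
proof (induction w)
  case Nil
  show ?case using fair_bits.emeasure_space_1 by simp
next
  case (Cons b w)
  have meas: "{\<omega>. stake (length (b # w)) \<omega> = b # w} \<in> sets fair_bits"
    using prefix_event_sets[of "length (b # w)" "{b # w}"] by simp
  have "emeasure fair_bits {\<omega>. stake (length (b # w)) \<omega> = b # w}
      = (\<integral>\<^sup>+ t. emeasure fair_bits {\<omega>. t = b \<and> stake (length w) \<omega> = w}
           \<partial>measure_pmf (bernoulli_pmf (1/2)))"
    using meas unfolding fair_bits_def
    by (subst prob_space.emeasure_stream_space[OF prob_space_measure_pmf]) (auto simp: space_stream_space)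
  also have "\<dots> = (\<integral>\<^sup>+ t. ennreal ((1/2) ^ length w) * indicator {b} t
           \<partial>measure_pmf (bernoulli_pmf (1/2)))"
    by (rule nn_integral_cong) (auto simp: Cons split: split_indicator)
  also have "\<dots> = ennreal ((1/2) ^ length w) * ennreal (1/2)"
    by (cases b) (simp_all add: nn_integral_cmult emeasure_pmf_single)
  also have "\<dots> = ennreal ((1/2) ^ length (b # w))"
    by (subst ennreal_mult'[symmetric]) (simp_all add: mult.commute)
  finally show ?case .
qed

lemma measure_stake_in:
  "measure fair_bits {\<omega>. stake k \<omega> \<in> X} = real (card {w. length w = k \<and> w \<in> X}) / 2 ^ k"
proof -
  let ?W = "{w. length w = k \<and> w \<in> X}"
  have fin: "finite ?W"
    by (rule finite_subset[OF _ finite_lists_length_eq[OF finite, of UNIV k]]) auto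
  have "{\<omega>. stake k \<omega> \<in> X} = (\<Union>w\<in>?W. {\<omega>. stake k \<omega> = w})"
    by auto
  also have "measure fair_bits \<dots> = (\<Sum>w\<in>?W. measure fair_bits {\<omega>. stake k \<omega> = w})"
    using fin prefix_event_sets[of k "{w}" for w]
    by (intro fair_bits.finite_measure_finite_Union) (auto simp: disjoint_family_on_def)
  also have "\<dots> = (\<Sum>w\<in>?W. (1/2) ^ k)"
    using emeasure_stake_eq by (intro sum.cong) (auto simp: measure_def)
  finally show ?thesis by (simp add: power_one_over field_simps)
qed

section \<open>Leaf events, output distribution and expected number of bits\<close>

definition leaf_event :: "'a ddg \<Rightarrow> nat \<Rightarrow> 'a \<Rightarrow> bool stream set" where
  "leaf_event t k i = {\<omega>. node_at t (stake k \<omega>) = Some (Leaf i)}"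

lemma leaf_event_sets [measurable]: "leaf_event t k i \<in> sets fair_bits"
  unfolding leaf_event_def using prefix_event_sets[of k "{w. node_at t w = Some (Leaf i)}"] by simp

lemma measure_leaf_event: "measure fair_bits (leaf_event t k i) = real (leaf_count t k i) / 2 ^ k"
  unfolding leaf_event_def leaf_count_def
  using measure_stake_in[of k "{w. node_at t w = Some (Leaf i)}"] by simp

text \<open>Leaves have no descendants, so the paths to leaves are prefix-free. This is what makes
  leaf events disjoint.\<close>

lemma node_at_below_Leaf:
  "node_at t v = Some (Leaf i) \<Longrightarrow> node_at t (v @ w) = Some s \<Longrightarrow> w = [] \<and> s = Leaf i"
proof (induction v arbitrary: t)
  case Nil
  then show ?case by (cases w) auto
next
  case (Cons b v)
  then show ?case by (cases t) auto
qed

lemma leaf_event_unique: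
  assumes "\<omega> \<in> leaf_event t k i" "\<omega> \<in> leaf_event t k' i'"
  shows "k = k' \<and> i = i'"
proof -
  have aux: "k = k' \<and> i = i'" if "k \<le> k'" "\<omega> \<in> leaf_event t k i" "\<omega> \<in> leaf_event t k' i'" for k k' i i'
  proof -
    have "stake k' \<omega> = stake k \<omega> @ stake (k' - k) (sdrop k \<omega>)"
      using that(1) by (metis le_add_diff_inverse stake_add)
    then have "node_at t (stake k \<omega> @ stake (k' - k) (sdrop k \<omega>)) = Some (Leaf i')"
      using that(3) unfolding leaf_event_def by (simp del: stake_add)
    then have "stake (k' - k) (sdrop k \<omega>) = [] \<and> Leaf i' = Leaf i"
      using that(2) unfolding leaf_event_def by (intro node_at_below_Leaf) auto
    then have "length (stake (k' - k) (sdrop k \<omega>)) = 0 \<and> i = i'" by auto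
    with that(1) show ?thesis by (simp del: length_0_conv)
  qed
  show ?thesis
  proof (cases "k \<le> k'")
    case True
    then show ?thesis using aux assms by blast
  next
    case False
    then have "k' \<le> k" by simp
    from aux[OF this assms(2,1)] show ?thesis by auto
  qed
qed

text \<open>The leaf events of different depths are disjoint, so countable additivity
  applies.\<close>

lemma outputs_sums:
  "(\<lambda>d. real (leaf_count (unroll t) d i) / 2 ^ d) sums measure fair_bits {\<omega>. outputs t \<omega> i}"
proof -
  have "{\<omega>. outputs t \<omega> i} = (\<Union>k. leaf_event (unroll t) k i)"
    by (auto simp: outputs_def leaf_event_def)
  moreover have "(\<lambda>k. measure fair_bits (leaf_event (unroll t) k i))
      sums measure fair_bits (\<Union>k. leaf_event (unroll t) k i)"
    by (rule fair_bits.finite_measure_UNION) (auto simp: disjoint_family_on_def dest: leaf_event_unique)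
  ultimately show ?thesis by (simp add: measure_leaf_event)
qed

lemma has_output_distribution_iff_sums:
  "has_output_distribution t P \<longleftrightarrow>
     (\<forall>i. (\<lambda>d. real (leaf_count (unroll t) d i) / 2 ^ d) sums P i)"
  unfolding has_output_distribution_def
proof -
  have "measure fair_bits {\<omega>. outputs t \<omega> i} = P i \<longleftrightarrow>
      (\<lambda>d. real (leaf_count (unroll t) d i) / 2 ^ d) sums P i" for i
    using outputs_sums[of t i] sums_unique2[OF outputs_sums[of t i], of "P i"] by auto
  then show "(\<forall>i. measure fair_bits {\<omega>. outputs t \<omega> i} = P i) \<longleftrightarrow>
      (\<forall>i. (\<lambda>d. real (leaf_count (unroll t) d i) / 2 ^ d) sums P i)"
    by simp
qed

lemma less_bits_consumed_iff:
  "enat k < bits_consumed t \<omega> \<longleftrightarrow> \<omega> \<notin> (\<Union>d\<in>{..k}. \<Union>i. leaf_event (unroll t) d i)"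
proof -
  have "bits_consumed t \<omega> \<le> enat k \<longleftrightarrow> (\<exists>d\<le>k. \<exists>i. \<omega> \<in> leaf_event (unroll t) d i)" (is "?L \<longleftrightarrow> ?R")
  proof
    assume ?R
    then obtain d i where "d \<le> k" "\<omega> \<in> leaf_event (unroll t) d i" by blast
    then have "bits_consumed t \<omega> \<le> enat d"
      unfolding bits_consumed_def by (intro Inf_lower) (auto simp: leaf_event_def)
    also have "enat d \<le> enat k" using \<open>d \<le> k\<close> by simp
    finally show ?L .
  next
    let ?S = "{enat k | k. \<exists>i. node_at (unroll t) (stake k \<omega>) = Some (Leaf i)}"
    assume L: ?L
    \<comment> \<open>The infimum of the empty set is infinite, so a finite bound gives a nonempty
      set, whose infimum is attained by well-ordering.\<close>
    then have "?S \<noteq> {}"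
      unfolding bits_consumed_def by (metis Inf_enat_def infinity_ileE)
    then obtain e where "e \<in> ?S" by blast
    then have "Inf ?S \<in> ?S" by (rule wellorder_InfI)
    with L show ?R unfolding bits_consumed_def[symmetric] by (auto simp: leaf_event_def)
  qed
  then show ?thesis by (auto simp flip: not_le)
qed

text \<open>The expectation of a variable with values in \<open>enat\<close> is the sum of its tail
  probabilities. The run exceeds \<open>k\<close> bits iff it avoids the disjoint leaf events up to
  depth \<open>k\<close>; finite support turns their probability into a finite sum.\<close>

lemma expected_bits_eq:
  assumes fin: "finite I" and supp: "\<And>d i. i \<notin> I \<Longrightarrow> leaf_count (unroll t) d i = 0"
  shows "expected_bits t =
    (\<Sum>k. ennreal (1 - (\<Sum>i\<in>I. \<Sum>d\<le>k. real (leaf_count (unroll t) d i) / 2 ^ d)))"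
proof -
  let ?E = "leaf_event (unroll t)"
  have empty: "?E d i = {}" if "i \<notin> I" for d i
  proof -
    have "finite {w. length w = d \<and> node_at (unroll t) w = Some (Leaf i)}"
      by (rule finite_subset[OF _ finite_lists_length_eq[OF finite, of UNIV d]]) auto
    then have "{w. length w = d \<and> node_at (unroll t) w = Some (Leaf i)} = {}"
      using supp[OF that, of d] unfolding leaf_count_def by simp
    moreover have "stake d \<omega> \<in> {w. length w = d \<and> node_at (unroll t) w = Some (Leaf i)}"
      if "\<omega> \<in> ?E d i" for \<omega>
      using that by (simp add: leaf_event_def)
    ultimately show ?thesis by blast
  qed
  have less: "{\<omega>. enat k < bits_consumed t \<omega>} = UNIV - (\<Union>p\<in>I \<times> {..k}. ?E (snd p) (fst p))" for k
  proof -
    have "(\<Union>d\<in>{..k}. \<Union>i. ?E d i) = (\<Union>p\<in>I \<times> {..k}. ?E (snd p) (fst p))"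
      using empty by fastforce
    then show ?thesis by (auto simp only: less_bits_consumed_iff)
  qed
  \<comment> \<open>The codomain is countable, so singletons suffice, and these are obtained from
    the tail events.\<close>
  have meas: "bits_consumed t \<in> fair_bits \<rightarrow>\<^sub>M count_space UNIV"
  proof (rule measurable_count_space_eq_countable[THEN iffD2])
    show "countable (UNIV :: enat set)" by simp
    have less_sets: "{\<omega>. enat k < bits_consumed t \<omega>} \<in> sets fair_bits" for k
      unfolding less using fin by (intro sets.Diff sets.finite_UN) (auto intro: sets.top[of fair_bits, simplified])
    have "bits_consumed t -` {a} \<in> sets fair_bits" for a
    proof (cases a)
      case (enat k)
      have "bits_consumed t -` {a} = (if k = 0 then UNIV else {\<omega>. enat (k - 1) < bits_consumed t \<omega>})
          - {\<omega>. enat k < bits_consumed t \<omega>}"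
      proof (rule Set.set_eqI)
        fix \<omega>
        show "\<omega> \<in> bits_consumed t -` {a} \<longleftrightarrow> \<omega> \<in> (if k = 0 then UNIV
            else {\<omega>. enat (k - 1) < bits_consumed t \<omega>}) - {\<omega>. enat k < bits_consumed t \<omega>}"
          by (cases "bits_consumed t \<omega>") (auto simp: enat)
      qed
      then show ?thesis using less_sets sets.top[of fair_bits] by auto
    next
      case infinity
      have "bits_consumed t -` {a} = (\<Inter>k. {\<omega>. enat k < bits_consumed t \<omega>})"
      proof (rule Set.set_eqI)
        fix \<omega>
        show "\<omega> \<in> bits_consumed t -` {a} \<longleftrightarrow> \<omega> \<in> (\<Inter>k. {\<omega>. enat k < bits_consumed t \<omega>})"
          by (cases "bits_consumed t \<omega>") (auto simp: infinity)
      qed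
      then show ?thesis using less_sets by auto
    qed
    then show "bits_consumed t \<in> space fair_bits \<rightarrow> UNIV \<and>
        (\<forall>a\<in>UNIV. bits_consumed t -` {a} \<inter> space fair_bits \<in> sets fair_bits)"
      by simp
  qed
  have "measure fair_bits (\<Union>p\<in>I \<times> {..k}. ?E (snd p) (fst p))
      = (\<Sum>i\<in>I. \<Sum>d\<le>k. real (leaf_count (unroll t) d i) / 2 ^ d)" for k
  proof -
    have "measure fair_bits (\<Union>p\<in>I \<times> {..k}. ?E (snd p) (fst p))
        = (\<Sum>p\<in>I \<times> {..k}. measure fair_bits (?E (snd p) (fst p)))"
      using fin by (intro fair_bits.finite_measure_finite_Union)
        (auto simp: disjoint_family_on_def dest: leaf_event_unique)
    then show ?thesis
      by (simp add: measure_leaf_event sum.cartesian_product case_prod_beta)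
  qed
  then have "emeasure fair_bits {\<omega>. enat k < bits_consumed t \<omega>}
      = ennreal (1 - (\<Sum>i\<in>I. \<Sum>d\<le>k. real (leaf_count (unroll t) d i) / 2 ^ d))" for k
    unfolding less using fin
    by (subst fair_bits.emeasure_eq_measure, subst fair_bits.prob_compl[simplified]) auto
  then show ?thesis
    unfolding expected_bits_def by (subst nn_integral_enat_function[OF meas]) simp
qed

section \<open>Binary digits\<close>

lemma eps_01: "eps d x = 0 \<or> eps d x = 1"
  unfolding eps_def by presburger

text \<open>Halving \<open>\<lfloor>2 * y\<rfloor>\<close> with integer division gives
  \<open>\<lfloor>y\<rfloor>\<close>; the remainder is the next digit.\<close>

lemma floor_powi_Suc: "\<lfloor>2 powi (d + 1) * x\<rfloor> = 2 * \<lfloor>2 powi d * x\<rfloor> + eps (d + 1) x"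
proof -
  have double: "2 powi (d + 1) * x = 2 * (2 powi d * x)"
    by (simp add: power_int_add)
  have "\<lfloor>2 * y\<rfloor> div 2 = \<lfloor>y\<rfloor>" for y :: real
    using floor_divide_real_eq_div[of 2 "2 * y"] by simp
  then have "\<lfloor>2 powi (d + 1) * x\<rfloor> div 2 = \<lfloor>2 powi d * x\<rfloor>"
    by (simp only: double)
  then show ?thesis
    unfolding eps_def by (metis mult_div_mod_eq)
qed

lemma floor_power2_Suc: "\<lfloor>2 ^ Suc d * x\<rfloor> = 2 * \<lfloor>2 ^ d * x\<rfloor> + eps (int (Suc d)) x"
  using floor_powi_Suc[of "int d" x] by (simp add: power_int_def nat_add_distrib add.commute)

lemma eps_0: "0 \<le> x \<Longrightarrow> x < 2 \<Longrightarrow> eps 0 x = \<lfloor>x\<rfloor>"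
  by (simp add: eps_def)

text \<open>The bound 2 ensures that digit 0 is the whole integer part. It admits
  \<open>x = 1\<close>, the case of a point mass.\<close>

lemma sum_eps_eq_floor:
  assumes "0 \<le> x" "x < 2"
  shows "(\<Sum>d\<le>k. real_of_int (eps (int d) x) / 2 ^ d) = real_of_int \<lfloor>2 ^ k * x\<rfloor> / 2 ^ k"
proof (induction k)
  case 0
  show ?case using eps_0[OF assms] by simp
next
  case (Suc k)
  have "(\<Sum>d\<le>Suc k. real_of_int (eps (int d) x) / 2 ^ d)
      = real_of_int \<lfloor>2 ^ k * x\<rfloor> / 2 ^ k + real_of_int (eps (int (Suc k)) x) / 2 ^ Suc k"
    by (simp only: sum.atMost_Suc Suc)
  also have "\<dots> = (2 * real_of_int \<lfloor>2 ^ k * x\<rfloor> + real_of_int (eps (int (Suc k)) x)) / 2 ^ Suc k"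
    by (simp add: field_simps del: of_nat_Suc)
  also have "\<dots> = real_of_int \<lfloor>2 ^ Suc k * x\<rfloor> / 2 ^ Suc k"
    by (simp only: floor_power2_Suc of_int_add of_int_mult of_int_numeral)
  finally show ?case .
qed

lemma floor_power2_bounds:
  "real_of_int \<lfloor>2 ^ k * x\<rfloor> / 2 ^ k \<le> x" "x - real_of_int \<lfloor>2 ^ k * x\<rfloor> / 2 ^ k \<le> (1/2) ^ k"
proof -
  have "real_of_int \<lfloor>2 ^ k * x\<rfloor> \<le> 2 ^ k * x" "2 ^ k * x - real_of_int \<lfloor>2 ^ k * x\<rfloor> \<le> 1"
    by linarith+
  then show "real_of_int \<lfloor>2 ^ k * x\<rfloor> / 2 ^ k \<le> x" "x - real_of_int \<lfloor>2 ^ k * x\<rfloor> / 2 ^ k \<le> (1/2) ^ k"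
    by (simp_all add: diff_divide_eq_iff divide_le_eq pos_divide_le_eq power_one_over divide_simps mult.commute)
qed

lemma floor_power2_tendsto: "(\<lambda>k. real_of_int \<lfloor>2 ^ k * x\<rfloor> / 2 ^ k) \<longlonglongrightarrow> x"
proof (rule tendsto_sandwich)
  show "\<forall>\<^sub>F k in sequentially. x - (1/2) ^ k \<le> real_of_int \<lfloor>2 ^ k * x\<rfloor> / 2 ^ k"
    using floor_power2_bounds(2)[of x] by (intro always_eventually allI) (simp add: algebra_simps)
  show "\<forall>\<^sub>F k in sequentially. real_of_int \<lfloor>2 ^ k * x\<rfloor> / 2 ^ k \<le> x"
    using floor_power2_bounds(1)[of _ x] by simp
  show "(\<lambda>k. x - (1/2) ^ k) \<longlonglongrightarrow> x"
    using tendsto_diff[OF tendsto_const LIMSEQ_power_zero[of "1/2 :: real"], of x] by simp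
qed simp

lemma eps_sums:
  assumes "0 \<le> x" "x < 2"
  shows "(\<lambda>d. real_of_int (eps (int d) x) / 2 ^ d) sums x"
  unfolding sums_def_le sum_eps_eq_floor[OF assms] by (rule floor_power2_tendsto)

lemma digit_fps_nth [simp]: "fps_nth (digit_fps x) d = eps (int d) x"
  by (simp add: digit_fps_def)

lemma eps_eq_0_le:
  assumes "0 \<le> x" "x < 1" "d \<le> 0"
  shows "eps d x = 0"
proof -
  have "2 powi d \<le> (1 :: real)"
    using power_int_increasing[of d 0 "2 :: real"] assms(3) by simp
  then have "2 powi d * x < 1"
    using assms(1,2) mult_left_le_one_le[of x "2 powi d"] by simp
  then have "\<lfloor>2 powi d * x\<rfloor> = 0"
    using assms(1) by (simp add: floor_eq_iff)
  then show ?thesis by (simp add: eps_def)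
qed

lemma ex_eps_eq_1:
  assumes "0 < x" "x < 2"
  shows "\<exists>d. eps (int d) x = 1"
proof (rule ccontr)
  assume "\<nexists>d. eps (int d) x = 1"
  then have "eps (int d) x = 0" for d using eps_01 by blast
  then have "(\<lambda>d. 0 :: real) sums x" using eps_sums[of x] assms by simp
  then have "x = 0" by (simp add: sums_iff)
  then show False using assms by simp
qed

text \<open>Among all expansions with natural digits, the binary one has the largest partial sums: each
  partial sum is a multiple of \<open>1 / 2 ^ k\<close>.\<close>

lemma dyadic_partial_sum_le:
  fixes c :: "nat \<Rightarrow> nat"
  assumes "(\<lambda>d. real (c d) / 2 ^ d) sums x"
  shows "(\<Sum>d\<le>k. real (c d) / 2 ^ d) \<le> real_of_int \<lfloor>2 ^ k * x\<rfloor> / 2 ^ k"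
proof -
  have "(\<Sum>d\<le>k. real (c d) / 2 ^ d) \<le> x"
    using sum_le_suminf[of "\<lambda>d. real (c d) / 2 ^ d" "{..k}"] sums_summable[OF assms]
      sums_unique[OF assms] by simp
  moreover have int: "2 ^ k * (\<Sum>d\<le>k. real (c d) / 2 ^ d) = real_of_int (\<Sum>d\<le>k. int (c d) * 2 ^ (k - d))"
    unfolding sum_distrib_left of_int_sum
    by (rule sum.cong) (auto simp: le_iff_add power_add)
  ultimately have "real_of_int (\<Sum>d\<le>k. int (c d) * 2 ^ (k - d)) \<le> 2 ^ k * x"
    by (simp only: int[symmetric] mult_le_cancel_left_pos zero_less_power zero_less_numeral)
  then have "real_of_int (\<Sum>d\<le>k. int (c d) * 2 ^ (k - d)) \<le> real_of_int \<lfloor>2 ^ k * x\<rfloor>"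
    by (simp only: of_int_le_iff le_floor_iff)
  then show ?thesis
    by (simp only: int[symmetric]) (simp add: field_simps)
qed

section \<open>The Knuth-Yao theorem\<close>

text \<open>Level \<open>d\<close> of the tree lists its leaves \<open>L d\<close> first; \<open>j\<close> is the position of a node within its
  level.\<close>

primcorec grow :: "(nat \<Rightarrow> 'a list) \<Rightarrow> nat \<Rightarrow> nat \<Rightarrow> 'a ddg" where
  "grow L d j =
    (if j < length (L d) then Leaf (L d ! j)
     else Node (grow L (Suc d) (2 * (j - length (L d))))
       (grow L (Suc d) (2 * (j - length (L d)) + 1)))"

lemma grow_Leaf: "j < length (L d) \<Longrightarrow> grow L d j = Leaf (L d ! j)"
  by (subst grow.code) simp

lemma grow_Node: "grow L d (length (L d) + j) = Node (grow L (Suc d) (2 * j)) (grow L (Suc d) (2 * j + 1))"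
  by (subst grow.code) simp

lemma back_count_grow: "back_count (grow L d j) e = 0"
proof (induction e arbitrary: d j)
  case 0
  show ?case by (subst grow.code) (simp add: back_count_0)
next
  case (Suc e)
  then show ?case by (subst grow.code) (simp add: back_count_Suc)
qed

text \<open>\<open>N d\<close> is the number of nodes on level \<open>d\<close>: each node that is
  not a leaf has two children. Summing over a whole level lets the induction on \<open>e\<close>
  pass from one level to the next.\<close>

lemma leaf_count_grow:
  fixes N :: "nat \<Rightarrow> nat"
  assumes N: "\<And>d. N (Suc d) = 2 * (N d - length (L d))" "\<And>d. length (L d) \<le> N d"
  shows "(\<Sum>j<N d. leaf_count (grow L d j) e i) = count_list (L (d + e)) i"
proof -
  have split: "(\<Sum>j<k + r. f j) = (\<Sum>j<k. f j) + (\<Sum>j<r. f (k + j))" for f :: "nat \<Rightarrow> nat" and k r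
    by (induction r) auto
  show ?thesis
  proof (induction e arbitrary: d)
    case 0
    obtain r where r: "N d = length (L d) + r" using N(2)[of d] le_Suc_ex by blast
    have "(\<Sum>j<N d. leaf_count (grow L d j) 0 i)
        = (\<Sum>j<length (L d). leaf_count (grow L d j) 0 i)
          + (\<Sum>j<r. leaf_count (grow L d (length (L d) + j)) 0 i)"
      unfolding r by (rule split)
    also have "\<dots> = (\<Sum>j<length (L d). if L d ! j = i then 1 else 0)"
      by (simp add: grow_Leaf grow_Node leaf_count_0)
    also have "\<dots> = card {j. j < length (L d) \<and> L d ! j = i}"
      by (simp add: sum.If_cases Int_def)
    also have "\<dots> = count_list (L d) i"
      by (simp add: count_list_eq_length_filter length_filter_conv_card eq_commute)
    finally show ?case by simp
  next
    case (Suc e)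
    obtain r where r: "N d = length (L d) + r" using N(2)[of d] le_Suc_ex by blast
    \<comment> \<open>The children at positions \<open>2 * j\<close> and \<open>2 * j + 1\<close>
      fill the next level without gaps or overlaps.\<close>
    have double: "(\<Sum>j<k. f (2 * j) + f (2 * j + 1)) = (\<Sum>j<2 * k. f j)" for f :: "nat \<Rightarrow> nat" and k
      by (induction k) auto
    have "(\<Sum>j<N d. leaf_count (grow L d j) (Suc e) i)
        = (\<Sum>j<length (L d). leaf_count (grow L d j) (Suc e) i)
          + (\<Sum>j<r. leaf_count (grow L d (length (L d) + j)) (Suc e) i)"
      unfolding r by (rule split)
    also have "\<dots> = (\<Sum>j<r. leaf_count (grow L (Suc d) (2 * j)) e i + leaf_count (grow L (Suc d) (2 * j + 1)) e i)"
      by (simp add: grow_Leaf grow_Node leaf_count_Leaf_Suc leaf_count_Node_Suc)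
    also have "\<dots> = (\<Sum>j<N (Suc d). leaf_count (grow L (Suc d) j) e i)"
      unfolding double[of "\<lambda>j. leaf_count (grow L (Suc d) j) e i"] by (simp add: N(1) r)
    finally show ?case by (simp add: Suc)
  qed
qed

text \<open>Level \<open>d\<close> receives one leaf for each label whose digit \<open>d\<close> is
  1. There is always room, since the truncated probabilities sum to at most 1.\<close>

lemma ex_knuth_yao_tree:
  fixes P :: "'a \<Rightarrow> real"
  assumes fin: "finite I" and nonneg: "\<And>i. 0 \<le> P i" and supp: "\<And>i. i \<notin> I \<Longrightarrow> P i = 0"
    and sum1: "sum P I = 1"
  shows "\<exists>t. \<forall>d i. int (leaf_count (unroll t) d i) = eps (int d) (P i)"
proof -
  have "\<exists>xs. set xs = {i \<in> I. eps (int d) (P i) = 1} \<and> distinct xs" for d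
    using fin by (intro finite_distinct_list) auto
  then obtain L where L: "\<And>d. set (L d) = {i \<in> I. eps (int d) (P i) = 1}" "\<And>d. distinct (L d)"
    by metis
  \<comment> \<open>\<open>f d\<close> is \<open>2 ^ d\<close> times the mass of all leaves up to
    depth \<open>d\<close>; hence \<open>2 ^ d - f d\<close> nodes of level \<open>d\<close> are
    internal, and \<open>N d\<close> counts all its nodes.\<close>
  define f where "f d = (\<Sum>i\<in>I. \<lfloor>2 ^ d * P i\<rfloor>)" for d
  define N where "N d = nat (2 ^ d - f d) + length (L d)" for d
  have len: "int (length (L d)) = (\<Sum>i\<in>I. eps (int d) (P i))" for d
  proof -
    have "int (length (L d)) = int (card {i \<in> I. eps (int d) (P i) = 1})"
      using distinct_card[OF L(2)[of d]] by (simp add: L(1))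
    also have "\<dots> = (\<Sum>i\<in>I. if eps (int d) (P i) = 1 then 1 else 0)"
      using fin by (simp add: sum.If_cases Int_def)
    also have "\<dots> = (\<Sum>i\<in>I. eps (int d) (P i))"
      using eps_01 by (intro sum.cong) fastforce+
    finally show ?thesis .
  qed
  have f_le: "f d \<le> 2 ^ d" for d
  proof -
    have "real_of_int (f d) \<le> (\<Sum>i\<in>I. 2 ^ d * P i)"
      unfolding f_def of_int_sum by (intro sum_mono) linarith
    also have "\<dots> = 2 ^ d" using sum1 by (simp flip: sum_distrib_left)
    finally show ?thesis by (simp flip: of_int_le_iff)
  qed
  have f_Suc: "f (Suc d) = 2 * f d + int (length (L (Suc d)))" for d
    unfolding f_def len floor_power2_Suc by (simp add: sum.distrib sum_distrib_left)
  have P_le: "P i \<le> 1" for i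
    using member_le_sum[of i I P] fin nonneg sum1 supp[of i] by fastforce
  have f_0: "f 0 = int (length (L 0))"
    unfolding f_def len using eps_0[OF nonneg le_less_trans[OF P_le]]
    by (intro sum.cong) auto
  have N_0: "N 0 = 1"
    using f_le[of 0] by (simp add: N_def f_0)
  have N_Suc: "N (Suc d) = 2 * (N d - length (L d))" for d
    using f_le[of d] f_le[of "Suc d"] by (simp add: N_def f_Suc nat_mult_distrib)
  have count: "leaf_count (grow L 0 0) d i = count_list (L d) i" for d i
    using leaf_count_grow[of N L 0 d i] N_Suc by (simp add: N_0) (simp add: N_def)
  \<comment> \<open>Without back edges, unrolling leaves the counts unchanged.\<close>
  have "back_fps (grow L 0 0) = 0"
    by (rule fps_ext) (simp add: back_count_grow)
  then have unroll: "leaf_fps (unroll (grow L 0 0)) i = leaf_fps (grow L 0 0) i" for i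
    using leaf_fps_unroll[of "grow L 0 0" i] by simp
  have "int (leaf_count (unroll (grow L 0 0)) d i) = eps (int d) (P i)" for d i
  proof -
    have "int (leaf_count (unroll (grow L 0 0)) d i) = int (count_list (L d) i)"
      using unroll[of i] by (metis leaf_fps_nth count)
    also have "\<dots> = (if i \<in> set (L d) then 1 else 0)"
    proof -
      have "distinct xs \<Longrightarrow> count_list xs i = (if i \<in> set xs then 1 else 0)" for xs
        by (induction xs) auto
      then show ?thesis using L(2)[of d] by simp
    qed
    also have "\<dots> = eps (int d) (P i)"
      using eps_01[of "int d" "P i"] supp[of i] by (auto simp: L(1) eps_def)
    finally show ?thesis .
  qed
  then show ?thesis by blast
qed

text \<open>Digit counts maximise every partial sum simultaneously, so they minimise every tail
  probability. Conversely, equal finite costs with termwise ordered tails force equality of all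
  tails, and hence of the counts.\<close>

theorem knuth_yao:
  fixes P :: "'a \<Rightarrow> real"
  assumes fin: "finite I" and nonneg: "\<And>i. 0 \<le> P i" and supp: "\<And>i. i \<notin> I \<Longrightarrow> P i = 0"
    and sum1: "sum P I = 1"
  shows "entropy_optimal P t \<longleftrightarrow> (\<forall>d i. int (leaf_count (unroll t) d i) = eps (int d) (P i))"
proof -
  have P_less: "P i < 2" for i
    using member_le_sum[of i I P] fin nonneg sum1 supp[of i] by fastforce
  \<comment> \<open>\<open>S t k i\<close> is the probability of output \<open>i\<close> within
    \<open>k\<close> bits, and \<open>F k i\<close> is \<open>P i\<close> truncated to
    \<open>k\<close> binary places.\<close>
  define S where "S t k i = (\<Sum>d\<le>k. real (leaf_count (unroll t) d i) / 2 ^ d)" for t :: "'a ddg" and k i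
  define F where "F k i = real_of_int \<lfloor>2 ^ k * P i\<rfloor> / 2 ^ k" for k i
  have bits: "expected_bits t = (\<Sum>k. ennreal (1 - (\<Sum>i\<in>I. S t k i)))"
    if "has_output_distribution t P" for t
    unfolding S_def
  proof (rule expected_bits_eq[OF fin])
    fix d i assume "i \<notin> I"
    then have "(\<lambda>d. real (leaf_count (unroll t) d i) / 2 ^ d) sums 0"
      using that supp by (metis has_output_distribution_iff_sums)
    then have "real (leaf_count (unroll t) d i) / 2 ^ d = 0"
      using suminf_eq_zero_iff[of "\<lambda>d. real (leaf_count (unroll t) d i) / 2 ^ d"]
      by (auto simp: sums_iff)
    then show "leaf_count (unroll t) d i = 0" by simp
  qed
  have S_le: "S t k i \<le> F k i" if "has_output_distribution t P" for t k i
    unfolding S_def F_def using that by (intro dyadic_partial_sum_le) (simp add: has_output_distribution_iff_sums)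
  have optimal: "has_output_distribution t P" "S t k i = F k i"
    if "\<forall>d i. int (leaf_count (unroll t) d i) = eps (int d) (P i)" for t k i
  proof -
    have eq: "real (leaf_count (unroll t) d i) = real_of_int (eps (int d) (P i))" for d i
      using that by (metis of_int_of_nat_eq)
    show "has_output_distribution t P"
      unfolding has_output_distribution_iff_sums eq using eps_sums nonneg P_less by blast
    show "S t k i = F k i"
      unfolding S_def F_def eq using sum_eps_eq_floor nonneg P_less by blast
  qed
  have F_le1: "(\<Sum>i\<in>I. F k i) \<le> 1" for k
    unfolding F_def sum1[symmetric] by (intro sum_mono floor_power2_bounds)
  \<comment> \<open>Truncation loses at most \<open>(1/2) ^ k\<close> per label, so the optimal cost
    is finite. With infinite costs, equality would say nothing about single terms.\<close>
  have summable_F: "summable (\<lambda>k. 1 - (\<Sum>i\<in>I. F k i))"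
  proof (rule summable_comparison_test')
    show "summable (\<lambda>k. real (card I) * (1/2) ^ k)" by (intro summable_mult summable_geometric) simp
    fix k :: nat
    have "1 - (\<Sum>i\<in>I. F k i) = (\<Sum>i\<in>I. P i - F k i)"
      using sum1 by (simp add: sum_subtractf)
    also have "\<dots> \<le> (\<Sum>i\<in>I. (1/2) ^ k)"
      unfolding F_def by (intro sum_mono floor_power2_bounds)
    finally show "norm (1 - (\<Sum>i\<in>I. F k i)) \<le> real (card I) * (1/2) ^ k"
      using F_le1[of k] by simp
  qed
  show ?thesis
  proof
    assume "\<forall>d i. int (leaf_count (unroll t) d i) = eps (int d) (P i)"
    note opt = optimal[OF this]
    have "expected_bits t \<le> expected_bits t'" if "has_output_distribution t' P" for t'
      unfolding bits[OF opt(1)] bits[OF that] opt(2)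
      by (intro suminf_le summableI ennreal_leI diff_left_mono sum_mono S_le that)
    then show "entropy_optimal P t" using opt(1) by (simp add: entropy_optimal_def)
  next
    assume t: "entropy_optimal P t"
    then have out: "has_output_distribution t P" by (simp add: entropy_optimal_def)
    have SF: "(\<Sum>i\<in>I. S t k i) \<le> (\<Sum>i\<in>I. F k i)" for k
      by (intro sum_mono S_le out)
    obtain t' where "\<forall>d i. int (leaf_count (unroll t') d i) = eps (int d) (P i)"
      using ex_knuth_yao_tree[OF assms] by blast
    note opt = optimal[OF this]
    have "(\<Sum>k. ennreal (1 - (\<Sum>i\<in>I. S t k i))) \<le> (\<Sum>k. ennreal (1 - (\<Sum>i\<in>I. F k i)))"
      using t opt(1) unfolding entropy_optimal_def bits[OF out] opt(2)[symmetric] bits[OF opt(1), symmetric]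
      by blast
    also have "\<dots> = ennreal (\<Sum>k. 1 - (\<Sum>i\<in>I. F k i))"
      using F_le1 summable_F by (intro suminf_ennreal2) auto
    finally have le: "(\<Sum>k. ennreal (1 - (\<Sum>i\<in>I. S t k i))) \<le> ennreal (\<Sum>k. 1 - (\<Sum>i\<in>I. F k i))" .
    have S_le1: "0 \<le> 1 - (\<Sum>i\<in>I. S t k i)" for k
      using SF[of k] F_le1[of k] by simp
    \<comment> \<open>The cost of \<open>t\<close> is below a finite bound, so the comparison can
      move from \<open>ennreal\<close> to real series.\<close>
    have summable_S: "summable (\<lambda>k. 1 - (\<Sum>i\<in>I. S t k i))"
      using S_le1 le by (intro summable_suminf_not_top) (auto simp: top_unique)
    have "ennreal (\<Sum>k. 1 - (\<Sum>i\<in>I. S t k i)) \<le> ennreal (\<Sum>k. 1 - (\<Sum>i\<in>I. F k i))"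
      using le suminf_ennreal2[OF S_le1 summable_S] by simp
    then have le': "(\<Sum>k. 1 - (\<Sum>i\<in>I. S t k i)) \<le> (\<Sum>k. 1 - (\<Sum>i\<in>I. F k i))"
      using F_le1 by (subst (asm) ennreal_le_iff) (auto intro!: suminf_nonneg summable_F)
    \<comment> \<open>A series of nonnegative terms whose sum is at most 0 vanishes
      termwise.\<close>
    have "(\<Sum>k. (\<Sum>i\<in>I. F k i) - (\<Sum>i\<in>I. S t k i)) = 0"
      "summable (\<lambda>k. (\<Sum>i\<in>I. F k i) - (\<Sum>i\<in>I. S t k i))"
    proof -
      have sm: "summable (\<lambda>k. (\<Sum>i\<in>I. F k i) - (\<Sum>i\<in>I. S t k i))"
        using summable_diff[OF summable_S summable_F] by simp
      moreover have "(\<Sum>k. (\<Sum>i\<in>I. F k i) - (\<Sum>i\<in>I. S t k i)) \<le> 0"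
        using le' suminf_diff[OF summable_S summable_F] by simp
      moreover have "0 \<le> (\<Sum>k. (\<Sum>i\<in>I. F k i) - (\<Sum>i\<in>I. S t k i))"
        using SF by (intro suminf_nonneg sm) simp
      ultimately show "(\<Sum>k. (\<Sum>i\<in>I. F k i) - (\<Sum>i\<in>I. S t k i)) = 0"
        "summable (\<lambda>k. (\<Sum>i\<in>I. F k i) - (\<Sum>i\<in>I. S t k i))" by auto
    qed
    then have "(\<Sum>i\<in>I. F k i) - (\<Sum>i\<in>I. S t k i) = 0" for k
      using SF suminf_eq_zero_iff[of "\<lambda>k. (\<Sum>i\<in>I. F k i) - (\<Sum>i\<in>I. S t k i)"] by simp
    then have "(\<Sum>i\<in>I. F k i - S t k i) = 0" for k
      by (simp add: sum_subtractf)
    then have eq_on: "S t k i = F k i" if "i \<in> I" for k i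
      using that fin S_le[OF out] by (subst (asm) sum_nonneg_eq_0_iff) auto
    have eq: "S t k i = S t' k i" for k i
    proof (cases "i \<in> I")
      case True
      then show ?thesis using eq_on opt(2) by simp
    next
      case False
      then have "F k i = 0" by (simp add: F_def supp)
      moreover have "0 \<le> S t k i" by (simp add: S_def sum_nonneg)
      ultimately show ?thesis using S_le[OF out, of k i] opt(2)[of k i] by simp
    qed
    \<comment> \<open>Counts are recovered as differences of consecutive partial sums.\<close>
    have "leaf_count (unroll t) d i = leaf_count (unroll t') d i" for d i
    proof (cases d)
      case 0
      then show ?thesis using eq[of 0 i] by (simp add: S_def)
    next
      case (Suc k)
      then show ?thesis using eq[of k i] eq[of "Suc k" i] by (simp add: S_def)
    qed
    then show "\<forall>d i. int (leaf_count (unroll t) d i) = eps (int d) (P i)"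
      using \<open>\<forall>d i. int (leaf_count (unroll t') d i) = eps (int d) (P i)\<close> by simp
  qed
qed

section \<open>The tree of FLDR\<close>

text \<open>Binary digits of probabilities summing to 1 saturate Kraft's inequality.\<close>

lemma back_count_eq_0:
  fixes Q :: "'a \<Rightarrow> real"
  assumes fin: "finite I" and nonneg: "\<And>i. 0 \<le> Q i" and sum1: "sum Q I = 1"
    and counts: "\<And>d i. i \<in> I \<Longrightarrow> int (leaf_count t d i) = eps (int d) (Q i)"
  shows "back_count t d = 0"
proof -
  have Q_less: "Q i < 2" if "i \<in> I" for i
    using member_le_sum[of i I Q] fin nonneg sum1 that by fastforce
  \<comment> \<open>Kraft's inequality leaves to back edges only the mass that the leaves up to
    depth \<open>D\<close> do not use; this mass tends to 0 as \<open>D\<close> grows.\<close>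
  have bound: "real (back_count t d) / 2 ^ d \<le> 1 - (\<Sum>i\<in>I. real_of_int \<lfloor>2 ^ D * Q i\<rfloor> / 2 ^ D)" if "d \<le> D" for D
  proof -
    have "real (\<Sum>d\<le>D. (back_count t d + (\<Sum>i\<in>I. leaf_count t d i)) * 2 ^ (D - d)) \<le> real (2 ^ D)"
      using kraft_leaves_back[OF fin, where D = D and t = t] by (simp only: of_nat_le_iff)
    moreover have "real (\<Sum>d\<le>D. (back_count t d + (\<Sum>i\<in>I. leaf_count t d i)) * 2 ^ (D - d))
        = 2 ^ D * (\<Sum>d\<le>D. (real (back_count t d) + (\<Sum>i\<in>I. real (leaf_count t d i))) / 2 ^ d)"
      unfolding of_nat_sum sum_distrib_left by (rule sum.cong) (auto simp: le_iff_add power_add)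
    ultimately have kraft: "(\<Sum>d\<le>D. (real (back_count t d) + (\<Sum>i\<in>I. real (leaf_count t d i))) / 2 ^ d) \<le> 1"
      by simp
    have "(\<Sum>d\<le>D. (real (back_count t d) + (\<Sum>i\<in>I. real (leaf_count t d i))) / 2 ^ d)
        = (\<Sum>d\<le>D. real (back_count t d) / 2 ^ d) + (\<Sum>i\<in>I. \<Sum>d\<le>D. real (leaf_count t d i) / 2 ^ d)"
      unfolding add_divide_distrib sum.distrib sum_divide_distrib by (subst (2) sum.swap) simp
    also have "(\<Sum>i\<in>I. \<Sum>d\<le>D. real (leaf_count t d i) / 2 ^ d)
        = (\<Sum>i\<in>I. real_of_int \<lfloor>2 ^ D * Q i\<rfloor> / 2 ^ D)"
    proof (rule sum.cong[OF refl])
      fix i assume "i \<in> I"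
      then have "real (leaf_count t d i) = real_of_int (eps (int d) (Q i))" for d
        using counts[of i d] by (metis of_int_of_nat_eq)
      then show "(\<Sum>d\<le>D. real (leaf_count t d i) / 2 ^ d) = real_of_int \<lfloor>2 ^ D * Q i\<rfloor> / 2 ^ D"
        using sum_eps_eq_floor[OF nonneg Q_less[OF \<open>i \<in> I\<close>], of D] by simp
    qed
    finally show ?thesis
      using kraft member_le_sum[of d "{..D}" "\<lambda>d. real (back_count t d) / 2 ^ d"] that by simp
  qed
  have "(\<lambda>D. 1 - (\<Sum>i\<in>I. real_of_int \<lfloor>2 ^ D * Q i\<rfloor> / 2 ^ D)) \<longlonglongrightarrow> 1 - (\<Sum>i\<in>I. Q i)"
    by (intro tendsto_intros floor_power2_tendsto)
  then have "real (back_count t d) / 2 ^ d \<le> 1 - (\<Sum>i\<in>I. Q i)"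
    by (rule LIMSEQ_le_const) (use bound in blast)
  then show ?thesis by (simp add: sum1 divide_le_eq)
qed

text \<open>The depth is large enough that the natural subtraction in the weight of label 0 does not
  truncate.\<close>

lemma sum_fldr_proposal:
  assumes "0 < (\<Sum>i=1..n. A i)"
  shows "(\<Sum>i\<in>{0..n}. fldr_proposal n A i) = 1"
proof -
  let ?M = "\<Sum>i=1..n. A i" and ?K = "fldr_depth n A"
  have "log 2 (real ?M) \<le> real ?K"
    by (simp add: fldr_depth_def) linarith
  then have M: "?M \<le> 2 ^ ?K"
    using assms by (intro le_power2_of_log_le)
  have "(\<Sum>i\<in>{0..n}. fldr_proposal n A i) = fldr_proposal n A 0 + (\<Sum>i=1..n. fldr_proposal n A i)"
    by (subst sum.atLeast_Suc_atMost) auto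
  also have "(\<Sum>i=1..n. fldr_proposal n A i) = (\<Sum>i=1..n. real (A i) / 2 ^ ?K)"
    by (rule sum.cong) (auto simp: fldr_proposal_def)
  also have "\<dots> = real ?M / 2 ^ ?K"
    by (simp add: sum_divide_distrib)
  finally show ?thesis
    using M by (simp add: fldr_proposal_def of_nat_diff flip: add_divide_distrib)
qed

text \<open>\<open>t0\<close> has no back edges of its own, so those of \<open>t\<close> are exactly
  the rejected leaves labelled 0, and the renewal equation gives the factor.\<close>

lemma leaf_fps_unroll_FLDR:
  assumes t: "is_FLDR n A t" and pos: "0 < (\<Sum>i=1..n. A i)"
  shows "(1 - digit_fps (fldr_proposal n A 0)) * leaf_fps (unroll t) i
      = (if i \<in> {1..n} then digit_fps (fldr_proposal n A i) else 0)"
proof -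
  obtain t0 where t0: "\<And>d i. int (leaf_count t0 d i) = eps (int d) (fldr_proposal n A i)"
    and t_eq: "t = reject 0 t0"
    using t unfolding is_FLDR_def by blast
  have nonneg: "0 \<le> fldr_proposal n A i" for i
    by (simp add: fldr_proposal_def)
  have "back_count t0 d = 0" for d
    by (rule back_count_eq_0[OF _ nonneg sum_fldr_proposal[OF pos] t0]) simp
  then have "back_fps t = digit_fps (fldr_proposal n A 0)"
    by (intro fps_ext) (simp add: t_eq back_count_reject t0)
  \<comment> \<open>Label 0 disappears by rejection, and labels above \<open>n\<close> have proposal
    probability 0.\<close>
  moreover have "leaf_fps t i = (if i \<in> {1..n} then digit_fps (fldr_proposal n A i) else 0)"
  proof (rule fps_ext)
    fix d
    show "fps_nth (leaf_fps t i) d = fps_nth (if i \<in> {1..n} then digit_fps (fldr_proposal n A i) else 0) d"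
      using t0[of d i] by (auto simp: t_eq leaf_count_reject fldr_proposal_def eps_def)
  qed
  ultimately show ?thesis
    using leaf_fps_unroll[of t i] by (simp add: algebra_simps)
qed

section \<open>Entropy optimality of ALDR\<close>

text \<open>By Knuth and Yao, optimality equates the unrolled leaf series with the digit series.
  Multiplying by the nonzero rejection factor replaces the former by the digits of the
  proposal.\<close>

lemma aldr_entropy_optimal_iff:
  fixes a :: "nat \<Rightarrow> nat"
  assumes m: "m = (\<Sum>i=1..n. a i)" "0 < m" "m \<le> 2 ^ K" and npow: "\<not> (\<exists>k. m = 2 ^ k)"
    and t: "is_ALDR n a K t"
    and P: "P = (\<lambda>i. if i \<in> {1..n} then real (a i) / real m else 0)"
  shows "entropy_optimal P t \<longleftrightarrow>
    (\<forall>i\<in>{1..n}. (1 - digit_fps (real (2 ^ K mod m) / 2 ^ K)) * digit_fps (P i)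
       = digit_fps (real (2 ^ K div m * a i) / 2 ^ K))"
proof -
  define c where "c = 2 ^ K div m"
  define A where "A = (\<lambda>i. c * a i)"
  define Q where "Q = fldr_proposal n A"
  have sumA: "(\<Sum>i=1..n. A i) = c * m"
    by (simp add: A_def m(1) sum_distrib_left)
  have cm: "2 ^ K = c * m + 2 ^ K mod m"
    unfolding c_def by simp
  have c: "1 \<le> c"
    using m(2,3) by (simp add: c_def Suc_leI div_greater_zero_iff)
  obtain k where K: "K = Suc k"
    using m(2,3) npow by (cases K) (auto simp: le_Suc_eq dest: spec[of _ 0])
  \<comment> \<open>The remainder is smaller than the accepted weight \<open>c * m\<close>, which
    therefore exceeds half of \<open>2 ^ K\<close>; so the depth chosen by FLDR is exactly
    \<open>K\<close>.\<close>
  have "2 ^ K mod m < c * m"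
    using m(2) c by (metis less_le_trans mod_less_divisor mult_le_mono1 mult_1)
  then have "2 ^ k < c * m" using cm by (simp add: K)
  moreover have "c * m \<le> 2 ^ (k + 1)" using cm by (simp add: K)
  ultimately have "\<lceil>log 2 (real (c * m))\<rceil> = int k + 1"
    using ceiling_log_nat_eq_if[of 2 k "c * m"] by simp
  then have depth: "fldr_depth n A = K"
    unfolding fldr_depth_def sumA by (simp add: K)
  have diff: "2 ^ K - c * m = 2 ^ K mod m"
    using cm by simp
  have Q_0: "Q 0 = real (2 ^ K mod m) / 2 ^ K"
    unfolding Q_def fldr_proposal_def depth sumA diff by simp
  have Q_i: "Q i = real (c * a i) / 2 ^ K" if "i \<in> {1..n}" for i
    using that unfolding Q_def fldr_proposal_def depth by (auto simp: A_def)
  have "is_FLDR n A t"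
    using t unfolding is_ALDR_def A_def c_def m(1) .
  moreover have "0 < (\<Sum>i=1..n. A i)"
    unfolding sumA using c m(2) by simp
  ultimately have unroll: "(1 - digit_fps (Q 0)) * leaf_fps (unroll t) i
      = (if i \<in> {1..n} then digit_fps (Q i) else 0)" for i
    unfolding Q_def by (rule leaf_fps_unroll_FLDR)
  have "2 ^ K mod m < 2 ^ K"
    using m(2,3) by (meson less_le_trans mod_less_divisor)
  then have "real (2 ^ K mod m) < real (2 ^ K)"
    by (simp only: of_nat_less_iff)
  then have "eps 0 (Q 0) = 0"
    unfolding Q_0 by (intro eps_eq_0_le) simp_all
  then have "fps_nth (1 - digit_fps (Q 0)) 0 \<noteq> 0" by simp
  \<comment> \<open>The rejection probability is below 1, so the constant coefficient is 1 and the
    factor can be cancelled.\<close>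
  then have nz: "1 - digit_fps (Q 0) \<noteq> 0" by (metis fps_zero_nth)
  have "entropy_optimal P t \<longleftrightarrow> (\<forall>d i. int (leaf_count (unroll t) d i) = eps (int d) (P i))"
  proof (rule knuth_yao)
    have "sum P {1..n} = (\<Sum>i=1..n. real (a i)) / real m"
      unfolding sum_divide_distrib by (rule sum.cong) (simp_all add: P)
    also have "\<dots> = 1"
      using m(2) unfolding of_nat_sum[symmetric] m(1)[symmetric] by simp
    finally show "sum P {1..n} = 1" .
  qed (auto simp: P)
  also have "\<dots> \<longleftrightarrow> (\<forall>i. leaf_fps (unroll t) i = digit_fps (P i))"
    by (auto simp: fps_eq_iff)
  also have "\<dots> \<longleftrightarrow> (\<forall>i. (1 - digit_fps (Q 0)) * digit_fps (P i) = (1 - digit_fps (Q 0)) * leaf_fps (unroll t) i)"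
    using nz by (simp only: mult_cancel_left) auto
  also have "\<dots> \<longleftrightarrow> (\<forall>i\<in>{1..n}. (1 - digit_fps (Q 0)) * digit_fps (P i) = digit_fps (Q i))"
  proof -
    have "digit_fps 0 = 0" by (rule fps_ext) (simp add: eps_def)
    then have "digit_fps (P i) = 0" if "i \<notin> {1..n}" for i
      using that by (auto simp: P)
    then show ?thesis unfolding unroll by (metis mult_zero_right)
  qed
  finally show ?thesis by (simp add: Q_0 Q_i c_def)
qed

text \<open>Two digits \<open>k1 \<noteq> k2\<close> of the rejection probability would both feed the coefficient
  \<open>d + k1 + k2\<close> of the unrolled tree, which is at most 1.\<close>

lemma digit_unique_of_rejection:
  fixes x y z :: real
  assumes eq: "(1 - digit_fps y) * digit_fps x = digit_fps z"
    and x: "0 < x" "x < 2"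
    and k: "eps (int k1) y = 1" "eps (int k2) y = 1"
  shows "k1 = k2"
proof (rule ccontr)
  assume neq: "k1 \<noteq> k2"
  have nonneg: "0 \<le> eps j w" for j w
    using eps_01[of j w] by auto
  have rec: "eps (int D) x = eps (int D) z + (\<Sum>j=0..D. eps (int j) y * eps (int (D - j)) x)" for D
  proof -
    have "digit_fps x = digit_fps z + digit_fps y * digit_fps x"
      using eq by (simp add: algebra_simps)
    then have "fps_nth (digit_fps x) D = fps_nth (digit_fps z + digit_fps y * digit_fps x) D"
      by simp
    then show ?thesis by (simp add: fps_mult_nth)
  qed
  have ge: "(\<Sum>j\<in>J. eps (int j) y * eps (int (D - j)) x) \<le> eps (int D) x" if "J \<subseteq> {0..D}" for J D
  proof -
    have "(\<Sum>j\<in>J. eps (int j) y * eps (int (D - j)) x) \<le> (\<Sum>j=0..D. eps (int j) y * eps (int (D - j)) x)"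
      using that nonneg by (intro sum_mono2) auto
    then show ?thesis using rec[of D] nonneg[of "int D" z] by simp
  qed
  obtain d where d: "eps (int d) x = 1" using ex_eps_eq_1[OF x] by blast
  \<comment> \<open>One rejection after \<open>k1\<close> or \<open>k2\<close> bits shifts digit
    \<open>d\<close>; a second rejection by the other amount makes both orders meet at
    \<open>d + k1 + k2\<close>.\<close>
  have "eps (int (d + k1)) x = 1" "eps (int (d + k2)) x = 1"
    using ge[of "{k1}" "d + k1"] ge[of "{k2}" "d + k2"] d k
      eps_01[of "int (d + k1)" x] eps_01[of "int (d + k2)" x] by auto
  then have "2 \<le> eps (int (d + k1 + k2)) x"
    using ge[of "{k1, k2}" "d + k1 + k2"] neq k by (simp add: algebra_simps)
  then show False using eps_01[of "int (d + k1 + k2)" x] by auto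
qed

text \<open>A remainder with a single binary digit is \<open>2 ^ j\<close>, so \<open>m\<close>
  divides \<open>2 ^ j * (2 ^ k - 1)\<close> with \<open>K = j + k\<close>. The odd part gives
  \<open>ord x 2 \<le> k\<close>, the even part \<open>u \<le> j\<close>.\<close>

lemma depth_ge_of_single_digit:
  fixes m u x K :: nat
  assumes m: "m = 2 ^ u * x" "1 < x" "odd x" and mK: "m \<le> 2 ^ K"
    and unique: "\<And>k1 k2. eps (int k1) (real (2 ^ K mod m) / 2 ^ K) = 1 \<Longrightarrow>
      eps (int k2) (real (2 ^ K mod m) / 2 ^ K) = 1 \<Longrightarrow> k1 = k2"
  shows "u + ord x 2 \<le> K"
proof -
  define r where "r = 2 ^ K mod m"
  have cop: "coprime (2 ^ j) x" for j :: nat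
    using m(3) by simp
  have "r \<noteq> 0"
  proof
    assume "r = 0"
    then have "x dvd 2 ^ K" unfolding r_def m(1) by (metis dvd_mult_right mod_0_imp_dvd)
    then show False using cop[of K] m(2) by (metis coprime_common_divisor_nat dvd_refl less_irrefl nat_dvd_1_iff_1 coprime_def)
  qed
  have "m > 0" using m by auto
  then have r_less: "r < 2 ^ K"
    using mK unfolding r_def by (meson less_le_trans mod_less_divisor)
  then have "real r < real (2 ^ K)" by (simp only: of_nat_less_iff)
  then have frac: "0 < real r / 2 ^ K" "real r / 2 ^ K < 2"
    using \<open>r \<noteq> 0\<close> by (simp_all add: divide_less_eq del: of_nat_less_iff of_nat_less_numeral_power_cancel_iff)
  obtain k where k: "eps (int k) (real r / 2 ^ K) = 1"
    using ex_eps_eq_1[OF frac] by blast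
  have "eps (int d) (real r / 2 ^ K) = (if d = k then 1 else 0)" for d
    using k unique[folded r_def, of d k] eps_01[of "int d" "real r / 2 ^ K"] by presburger
  then have "(\<lambda>d. if d = k then 1 / 2 ^ d else 0)
      = (\<lambda>d. real_of_int (eps (int d) (real r / 2 ^ K)) / 2 ^ d)"
    by auto
  then have "(\<lambda>d. if d = k then 1 / 2 ^ d else 0) sums (real r / 2 ^ K)"
    using eps_sums[of "real r / 2 ^ K"] frac by simp
  then have "real r / 2 ^ K = 1 / 2 ^ k"
    by (rule sums_unique2[OF _ sums_single[of k "\<lambda>d. 1 / 2 ^ d"]])
  then have "real (r * 2 ^ k) = real (2 ^ K)"
    by (simp add: field_simps)
  then have rk: "r * 2 ^ k = 2 ^ K" by (simp only: of_nat_eq_iff)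
  then have "r dvd 2 ^ K" by (metis dvd_triv_left)
  then obtain j where j: "r = 2 ^ j"
    using divides_primepow_nat[OF two_is_prime_nat] by blast
  have K: "K = j + k"
    using rk unfolding j by (simp flip: power_add)
  \<comment> \<open>For \<open>k = 0\<close> divisibility by the order would give no bound.\<close>
  have "k \<noteq> 0" using r_less by (simp add: j K)
  have "m dvd 2 ^ K - r"
    unfolding r_def by (simp add: dvd_minus_mod)
  also have "2 ^ K - r = 2 ^ j * (2 ^ k - 1)"
    by (simp add: K j power_add algebra_simps)
  finally have dvd: "2 ^ u * x dvd 2 ^ j * (2 ^ k - 1)" unfolding m(1) .
  have "x dvd 2 ^ k - 1"
    using dvd cop[of j] by (metis coprime_commute coprime_dvd_mult_right_iff dvd_mult_right)
  then have "[2 ^ k = 1] (mod x)"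
    by (simp add: cong_altdef_nat cong_sym)
  then have "ord x 2 dvd k"
    by (simp only: ord_divides)
  then have "ord x 2 \<le> k" using \<open>k \<noteq> 0\<close> by (intro dvd_imp_le) auto
  moreover have "u \<le> j"
  proof -
    have "coprime (2 ^ u) (2 ^ k - 1 :: nat)"
      using \<open>k \<noteq> 0\<close> by simp
    moreover have "2 ^ u dvd 2 ^ j * (2 ^ k - 1 :: nat)"
      using dvd by (metis dvd_mult_left)
    ultimately have "2 ^ u dvd (2 ^ j :: nat)"
      by (simp add: coprime_dvd_mult_left_iff)
    then show ?thesis by (simp add: dvd_power_iff_le)
  qed
  ultimately show ?thesis by (simp add: K)
qed

section \<open>Subtraction without borrow\<close>

text \<open>The integers compared consist of the first \<open>j\<close> digits after the point;
  scaled down, they converge to the fractional parts.\<close>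

lemma frac_le_of_eps_le:
  assumes "\<And>j. 1 \<le> j \<Longrightarrow> eps (int j) y \<le> eps (int j) z"
  shows "frac y \<le> frac z"
proof -
  have "\<lfloor>2 ^ j * y\<rfloor> - 2 ^ j * \<lfloor>y\<rfloor> \<le> \<lfloor>2 ^ j * z\<rfloor> - 2 ^ j * \<lfloor>z\<rfloor>" for j :: nat
  proof (induction j)
    case (Suc j)
    then show ?case
      unfolding floor_power2_Suc using assms[of "Suc j"] by simp
  qed simp
  then have le: "real_of_int (\<lfloor>2 ^ j * y\<rfloor> - 2 ^ j * \<lfloor>y\<rfloor>) / 2 ^ j
      \<le> real_of_int (\<lfloor>2 ^ j * z\<rfloor> - 2 ^ j * \<lfloor>z\<rfloor>) / 2 ^ j" for j :: nat
    by (intro divide_right_mono) (simp_all only: of_int_le_iff, simp)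
  have lim: "(\<lambda>j. real_of_int (\<lfloor>2 ^ j * w\<rfloor> - 2 ^ j * \<lfloor>w\<rfloor>) / 2 ^ j) \<longlonglongrightarrow> frac w" for w :: real
    using tendsto_diff[OF floor_power2_tendsto tendsto_const, of w "real_of_int \<lfloor>w\<rfloor>"]
    by (simp add: frac_def diff_divide_distrib)
  show ?thesis by (rule LIMSEQ_le[OF lim lim]) (use le in blast)
qed

lemma eps_powi_mult: "eps j (2 powi k * x) = eps (j + k) x"
  by (simp add: eps_def power_int_add mult.assoc)

text \<open>Dividing by \<open>2 ^ l\<close> shifts digits by \<open>l\<close>. Digitwise domination
  orders the fractional parts at every scale, so no borrow crosses any position.\<close>

lemma eps_scaled_difference:
  assumes p: "0 \<le> p" "p < 1"
    and le: "\<And>d. 1 \<le> d \<Longrightarrow> eps d p \<le> eps (d + int l) p"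
  shows "eps k (p - p / 2 ^ l) = eps k p - eps (k - int l) p"
proof -
  \<comment> \<open>At \<open>d \<le> 0\<close> the left digit vanishes, so the hypothesis extends
    to all integers.\<close>
  have le': "eps d p \<le> eps (d + int l) p" for d
    using le[of d] eps_eq_0_le[OF p, of d] eps_01[of "d + int l" p] by (cases "1 \<le> d") auto
  let ?y = "2 powi (k - int l) * p" and ?z = "2 powi k * p"
  have "frac ?y \<le> frac ?z"
  proof (rule frac_le_of_eps_le)
    fix j :: nat
    show "eps (int j) ?y \<le> eps (int j) ?z"
      unfolding eps_powi_mult using le'[of "int j + (k - int l)"] by (simp add: algebra_simps)
  qed
  \<comment> \<open>The difference of the fractional parts lies in [0,1), so the floor is additive
    here.\<close>
  then have "\<lfloor>?z - ?y\<rfloor> = \<lfloor>?z\<rfloor> - \<lfloor>?y\<rfloor>"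
    using frac_ge_0[of ?y] frac_lt_1[of ?z] unfolding floor_eq_iff frac_def of_int_diff by linarith
  moreover have "2 powi k * (p - p / 2 ^ l) = ?z - ?y"
    by (simp add: power_int_diff algebra_simps)
  ultimately have "eps k (p - p / 2 ^ l) = (\<lfloor>?z\<rfloor> - \<lfloor>?y\<rfloor>) mod 2"
    by (simp add: eps_def)
  also have "\<dots> = (eps k p - eps (k - int l) p) mod 2"
    unfolding eps_def by (simp add: mod_diff_eq)
  also have "\<dots> = eps k p - eps (k - int l) p"
    using le'[of "k - int l"] eps_01[of k p] eps_01[of "k - int l" p] by auto
  finally show ?thesis .
qed

text \<open>The number is \<open>1 / 2 ^ l\<close>, with a single digit at \<open>l\<close>. It is
  the rejection probability of ALDR at depth \<open>u + l\<close>.\<close>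

lemma digit_fps_power2_quotient: "digit_fps (real (2 ^ u) / 2 ^ (u + l)) = fps_X ^ l"
proof (rule fps_ext)
  fix d
  have "2 ^ u div 2 ^ (u + l - d) mod 2 = (if d = l then 1 else 0 :: nat)" if "d \<le> u + l"
  proof (cases "d < l")
    case True
    then have "(2::nat) ^ u < 2 ^ (u + l - d)" by (intro power_strict_increasing) auto
    then show ?thesis using True by simp
  next
    case False
    then obtain e where "d = l + e" using le_Suc_ex not_less by blast
    with that obtain v where "u = e + v" using le_Suc_ex by fastforce
    with \<open>d = l + e\<close> show ?thesis by (cases e) (simp_all add: power_add)
  qed
  then show "fps_nth (digit_fps (real (2 ^ u) / 2 ^ (u + l))) d = fps_nth (fps_X ^ l) d"
    unfolding digit_fps_nth eps_dyadic by auto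
qed

section \<open>Equivalence of the optimality and digit conditions\<close>

theorem theorem5p6:
  fixes n m u x l c :: nat
    and a :: "nat \<Rightarrow> nat"
    and p q P :: "nat \<Rightarrow> real"
    and ALDR :: "nat \<Rightarrow> nat ddg"
  assumes a_pos: "\<And>i. i \<in> {1..n} \<Longrightarrow> 0 < a i"
    and a_gcd: "Gcd (a ` {1..n}) = 1"
    and m_def: "m = (\<Sum>i=1..n. a i)"
    and m_not_pow2: "\<not> (\<exists>k. m = 2 ^ k)"
    and p_def: "\<And>i. i \<in> {1..n} \<Longrightarrow> p i = real (a i) / real m"
    and P_def: "P = (\<lambda>i. if i \<in> {1..n} then p i else 0)"
    and m_decomp: "m = 2 ^ u * x" "1 < x" "odd x"
    and l_def: "l = ord x 2"
    and c_def: "c = 2 ^ (u + l) div m"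
    and q_def: "\<And>i. i \<in> {1..n} \<Longrightarrow> q i = real (c * a i) / 2 ^ (u + l)"
    and ALDR: "\<And>K. \<lceil>log 2 (real m)\<rceil> \<le> int K \<Longrightarrow> is_ALDR n a K (ALDR K)"
  shows "all_equivalent
    [\<exists>K. \<lceil>log 2 (real m)\<rceil> \<le> int K \<and> K \<le> u + l \<and> entropy_optimal P (ALDR K),
     entropy_optimal P (ALDR (u + l)),
     \<forall>i\<in>{1..n}. (1 - fps_X ^ l) * digit_fps (p i) = digit_fps (q i),
     \<forall>i\<in>{1..n}. \<forall>d. 0 \<le> fps_nth ((1 - fps_X ^ l) * digit_fps (p i)) d,
     \<forall>d\<ge>1. \<forall>i\<in>{1..n}. eps d (p i) \<le> eps (d + int l) (p i)]"
    (is "all_equivalent [?E1, ?E2, ?E3, ?E4, ?E5]")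
proof -
  have m_pos: "0 < m" using m_decomp by auto
  then obtain i0 where i0: "i0 \<in> {1..n}" unfolding m_def by (metis sum.empty less_irrefl ex_in_conv)
  have P_eq: "P = (\<lambda>i. if i \<in> {1..n} then real (a i) / real m else 0)"
    using P_def p_def by auto
  have p_range: "0 < p i" "p i < 1" if i: "i \<in> {1..n}" for i
  proof -
    show "0 < p i" using p_def[OF i] a_pos[OF i] m_pos by simp
    have "a i \<le> m" unfolding m_def using i by (intro member_le_sum) auto
    moreover have "a i \<noteq> m"
    proof
      assume "a i = m"
      moreover have "m = a i + sum a ({1..n} - {i})"
        unfolding m_def using i by (intro sum.remove) auto
      ultimately have "sum a ({1..n} - {i}) = 0" by simp
      then have "\<forall>j\<in>{1..n} - {i}. a j = 0" by simp
      then have "j = i" if "j \<in> {1..n}" for j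
        using a_pos[OF that] that by (metis DiffI less_irrefl singletonD)
      then have "{1..n} = {i}" using i by blast
      \<comment> \<open>With a single label the gcd is \<open>a i = m\<close>, so \<open>m\<close>
        would be \<open>2 ^ 0\<close>.\<close>
      then have "m = 1" using a_gcd \<open>a i = m\<close> by simp
      then show False using m_not_pow2 power_0 by metis
    qed
    ultimately show "p i < 1" using p_def[OF i] m_pos by simp
  qed
  have cop: "coprime x 2" using m_decomp(3) by simp
  have l_pos: "0 < l" unfolding l_def using cop by (simp add: ord_eq_0 gr0I)
  have "[2 ^ l = 1] (mod x)" unfolding l_def by (rule ord)
  then have "x dvd 2 ^ l - 1" by (metis cong_to_1_nat)
  then obtain e where e: "2 ^ l - 1 = x * e" by blast
  then have e': "2 ^ l = x * e + 1" using one_le_power[of "2::nat" l] by linarith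
  \<comment> \<open>Since \<open>2 ^ u < m\<close>, this is division with remainder: the quotient
    \<open>c\<close> is \<open>(2 ^ l - 1) / x\<close> and the remainder is
    \<open>2 ^ u\<close>.\<close>
  have "2 ^ (u + l) = m * e + 2 ^ u"
    by (simp add: power_add e' m_decomp(1) algebra_simps)
  moreover have "2 ^ u < m" using m_decomp by simp
  ultimately have c_eq: "c = e" and rem: "2 ^ (u + l) mod m = 2 ^ u"
    unfolding c_def using m_pos by simp_all
  have "e \<noteq> 0"
  proof
    assume "e = 0"
    with e' have "(2::nat) ^ l = 1" by simp
    with l_pos show False by (simp add: power_eq_1_iff)
  qed
  then have m_le: "m \<le> 2 ^ (u + l)"
    unfolding \<open>2 ^ (u + l) = m * e + 2 ^ u\<close> by (simp add: trans_le_add1)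
  have "log 2 (real m) \<le> real (u + l)"
  proof -
    have "real m \<le> real (2 ^ (u + l))" using m_le by (simp only: of_nat_le_iff)
    then show ?thesis using m_pos by (simp add: log_le_iff powr_realpow del: of_nat_add)
  qed
  then have ceil: "\<lceil>log 2 (real m)\<rceil> \<le> int (u + l)"
    by (simp add: ceiling_le_iff)
  have le_pow: "m \<le> 2 ^ K" if "\<lceil>log 2 (real m)\<rceil> \<le> int K" for K
    using that m_pos by (intro le_power2_of_log_le) (simp_all add: ceiling_le_iff)
  have optimal_iff: "entropy_optimal P (ALDR K) \<longleftrightarrow>
      (\<forall>i\<in>{1..n}. (1 - digit_fps (real (2 ^ K mod m) / 2 ^ K)) * digit_fps (P i)
         = digit_fps (real (2 ^ K div m * a i) / 2 ^ K))"
    if "\<lceil>log 2 (real m)\<rceil> \<le> int K" for K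
    using aldr_entropy_optimal_iff[OF m_def m_pos le_pow[OF that] m_not_pow2 ALDR[OF that] P_eq] .
  have "?E2 \<longleftrightarrow> ?E3"
    unfolding optimal_iff[OF ceil] rem digit_fps_power2_quotient
    by (simp add: P_def q_def c_def)
  \<comment> \<open>Optimality at \<open>K\<close>, used for the one label \<open>i0\<close>, forces
    a single rejection digit and hence \<open>K = u + l\<close>.\<close>
  moreover have "?E1 \<longleftrightarrow> ?E2"
  proof
    assume ?E1
    then obtain K where K: "\<lceil>log 2 (real m)\<rceil> \<le> int K" "K \<le> u + l" "entropy_optimal P (ALDR K)"
      by blast
    then have eq: "(1 - digit_fps (real (2 ^ K mod m) / 2 ^ K)) * digit_fps (p i0)
         = digit_fps (real (2 ^ K div m * a i0) / 2 ^ K)"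
      using optimal_iff i0 by (simp add: P_def)
    have p_less_2: "p i0 < 2" using p_range(2)[OF i0] by simp
    have "u + l \<le> K"
      unfolding l_def
      using m_decomp le_pow[OF K(1)]
      by (rule depth_ge_of_single_digit)
        (erule (1) digit_unique_of_rejection[OF eq p_range(1)[OF i0] p_less_2])
    then show ?E2 using K by simp
  qed (use ceil in blast)
  \<comment> \<open>For \<open>d < l\<close> the shifted series contributes 0, in agreement with the
    vanishing digits at negative indices.\<close>
  moreover have nth: "fps_nth ((1 - fps_X ^ l) * digit_fps (p i)) d
      = eps (int d) (p i) - eps (int d - int l) (p i)" if "i \<in> {1..n}" for i d
    using eps_eq_0_le[of "p i" "int d - int l"] p_range[OF that]
    by (simp add: left_diff_distrib fps_X_power_mult_nth of_nat_diff)
  have "?E4 \<longleftrightarrow> ?E5"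
  proof
    assume E4: ?E4
    show ?E5
    proof (intro allI impI ballI)
      fix d :: int and i assume "1 \<le> d" "i \<in> {1..n}"
      then show "eps d (p i) \<le> eps (d + int l) (p i)"
        using bspec[OF E4, of i, THEN spec, of "nat d + l"] nth[of i "nat d + l"] by simp
    qed
  next
    assume E5: ?E5
    show ?E4
    proof (intro ballI allI)
      fix i d assume i: "i \<in> {1..n}"
      have "eps (int d - int l) (p i) \<le> eps (int d) (p i)"
      proof (cases "1 \<le> int d - int l")
        case True
        then show ?thesis using E5 i by (metis diff_add_cancel)
      next
        case False
        then show ?thesis
          using eps_eq_0_le[of "p i" "int d - int l"] p_range[OF i] eps_01[of "int d" "p i"] by auto
      qed
      then show "0 \<le> fps_nth ((1 - fps_X ^ l) * digit_fps (p i)) d"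
        by (simp only: nth[OF i])
    qed
  qed
  \<comment> \<open>The coefficients on the right of \<open>?E3\<close> are digits.\<close>
  moreover have "?E3 \<Longrightarrow> ?E4"
    using eps_01 by (metis digit_fps_nth order.refl zero_le_one)
  moreover have "?E5 \<Longrightarrow> ?E3"
  proof (intro ballI fps_ext)
    fix i d assume E5: ?E5 and i: "i \<in> {1..n}"
    \<comment> \<open>This identity gives \<open>q i = p i * (1 - 1 / 2 ^ l)\<close>, the difference
      to which borrow-free subtraction applies.\<close>
    have "real c * real x = 2 ^ l - 1"
      unfolding c_eq using arg_cong[OF e', of real] by (simp add: mult.commute)
    then have "p i - p i / 2 ^ l = p i * (real c * real x) / 2 ^ l"
      by (simp only:) (simp add: field_simps)
    also have "\<dots> = q i"
      using m_decomp(2) unfolding q_def[OF i] p_def[OF i] m_decomp(1)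
      by (simp add: power_add)
    finally have "q i = p i - p i / 2 ^ l" ..
    then show "fps_nth ((1 - fps_X ^ l) * digit_fps (p i)) d = fps_nth (digit_fps (q i)) d"
      unfolding nth[OF i] digit_fps_nth
      using eps_scaled_difference[of "p i" l "int d"] p_range[OF i] E5 i by simp
  qed
  ultimately have "(?E1 \<longleftrightarrow> ?E2) \<and> (?E2 \<longleftrightarrow> ?E3) \<and> (?E3 \<longleftrightarrow> ?E4) \<and> (?E4 \<longleftrightarrow> ?E5)"
    by blast
  then show ?thesis unfolding all_equivalent_def by simp
qed

end
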